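(* Let $(\mathcal T_i)_{i\in\mathbb N_0}$ be a generalised preferential attachment tree with deterministic attachment function $f:\mathbb N_0\to(0,\infty)$, and assume that for some $\kappa>0$ and all $n\in\mathbb N_0$, \[\max_{i\le n}\frac{f(i)}{i+1}\le\kappa\frac{f(n)}{n+1}.\] Then almost surely $(\mathcal T_i)_{i\in\mathbb N_0}$ contains a unique persistent hub.
   Context: Generalised preferential attachment tree with deterministic $f:\mathbb N_0\to(0,\infty)$: $\mathcal T_0$ is a single node labelled $0$; given $\mathcal T_k$ (nodes $0,\dots,k$), choose a node $j$ with probability $f(\deg^+(j,\mathcal T_k))/\mathcal Z_k$, where $\mathcal Z_k=\sum_{j=0}^kf(\deg^+(j,\mathcal T_k))$, and add node $k+1$ with an edge directed from $j$ to $k+1$. $\deg^+(u,T)$ is the out-degree of $u$ in the directed tree $T$ ($-\infty$ if $u\notin T$). For a sequence of directed trees $(\mathcal T_n)$, $u$ is a persistent hub if $\deg^+(u,\mathcal T_n)=\max_{v\in\mathcal T_n}\deg^+(v,\mathcal T_n)$ for all but finitely many $n$; it is a unique persistent hub if moreover every persistent hub equals $u$. *)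

theory Defs
  imports "HOL-Probability.Probability"
begin

text \<open>A directed tree on nodes 0..n grown by attaching node k+1 (k \<ge> 0) to a parent
  is encoded by its parent function p :: nat \<Rightarrow> nat, where p k (for 1 \<le> k) is the
  parent of node k, i.e. the edge is directed from p k to k.  The tree T_n consists of
  nodes 0..n and the edges (p k, k) for 1 \<le> k \<le> n.\<close>

definition outdeg :: "(nat \<Rightarrow> nat) \<Rightarrow> nat \<Rightarrow> nat \<Rightarrow> nat" where
  "outdeg p n u = card {k \<in> {1..n}. p k = u}"

definition Zsum :: "(nat \<Rightarrow> real) \<Rightarrow> (nat \<Rightarrow> nat) \<Rightarrow> nat \<Rightarrow> real" where
  "Zsum f p n = (\<Sum>j\<le>n. f (outdeg p n j))"

definition attach_prob :: "(nat \<Rightarrow> real) \<Rightarrow> (nat \<Rightarrow> nat) \<Rightarrow> nat \<Rightarrow> nat \<Rightarrow> real" where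
  "attach_prob f p k j = (if j \<le> k then f (outdeg p k j) / Zsum f p k else 0)"

text \<open>X is a generalised preferential attachment tree process with attachment function f
  on the probability space M: X \<omega> is the (random) parent function, each coordinate is a
  random variable, and the finite-dimensional distributions are those of the sequential
  construction (this determines the law of the whole process).\<close>
definition gpa_tree :: "'a measure \<Rightarrow> (nat \<Rightarrow> real) \<Rightarrow> ('a \<Rightarrow> nat \<Rightarrow> nat) \<Rightarrow> bool" where
  "gpa_tree M f X \<longleftrightarrow>
     prob_space M \<and>
     (\<forall>k. (\<lambda>\<omega>. X \<omega> k) \<in> measurable M (count_space UNIV)) \<and>
     (\<forall>n q. measure M {\<omega> \<in> space M. \<forall>k\<in>{1..n}. X \<omega> k = q k}
              = (\<Prod>k<n. attach_prob f q k (q (Suc k))))"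

text \<open>u is a persistent hub of the tree sequence (T_n): for all but finitely many n,
  u belongs to T_n and its out-degree is maximal in T_n (nodes outside T_n have
  out-degree -\<infinity>, so they cannot attain the maximum).\<close>
definition persistent_hub :: "(nat \<Rightarrow> nat) \<Rightarrow> nat \<Rightarrow> bool" where
  "persistent_hub p u \<longleftrightarrow>
     (\<forall>\<^sub>F n in sequentially. u \<le> n \<and> (\<forall>v\<le>n. outdeg p n v \<le> outdeg p n u))"

definition unique_persistent_hub :: "(nat \<Rightarrow> nat) \<Rightarrow> nat \<Rightarrow> bool" where
  "unique_persistent_hub p u \<longleftrightarrow> persistent_hub p u \<and> (\<forall>v. persistent_hub p v \<longrightarrow> v = u)"

end

theory Submission
  imports Defs
begin

text \<open>
  Watch two vertices of out-degrees \<open>a\<close> and \<open>b\<close> only when one of them gains a child: the first one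
  does with probability \<open>f a / (f a + f b)\<close>. A nonnegative superharmonic function of this race that
  is at least 1 at the ties bounds the probability of a tie by its initial value.

  For a newcomer against the leader at its birth, of degree \<open>m\<close>, the product of \<open>1 + l / f i\<close> over
  \<open>i < b\<close> and of \<open>1 - l / f i\<close> over \<open>m \<le> i < a\<close> is harmonic; with \<open>l\<close> of order \<open>r f m / m\<close> it
  shows that the newcomer ever catches up with probability \<open>O(m powr - r)\<close>. The growth condition
  makes the leader gain a child at time \<open>k\<close> with probability at least \<open>(m + 1) / (\<kappa> (2 k + 1))\<close>, so the
  maximal degree grows polynomially and, by Borel-Cantelli, only finitely many vertices ever lead.

  For two fixed vertices, attach independent exponential clocks of rates \<open>f a, f (a + 1), \<dots>\<close> and
  \<open>f b, f (b + 1), \<dots>\<close>. By memorylessness, the probability that the two total waiting times differ by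
  at most \<open>\<epsilon>\<close> is harmonic for the race. It is \<open>O(\<epsilon>)\<close> at the start, as the first waiting time has a
  bounded density, and close to 1 at ties of high degree, as \<open>1 / f i ^ 2\<close> is summable. Hence ties of
  high degree do not occur, and the lead changes only finitely often.
\<close>

section \<open>Conditional expectations along the growing tree\<close>

text \<open>\<open>cont_expect f i k G q\<close> is the expectation of \<open>G\<close> at time \<open>k + i\<close> given the code \<open>q\<close> of the
  tree at time \<open>k\<close>.\<close>

primrec cont_expect ::
  "(nat \<Rightarrow> real) \<Rightarrow> nat \<Rightarrow> nat \<Rightarrow> ((nat \<Rightarrow> nat) \<Rightarrow> real) \<Rightarrow> (nat \<Rightarrow> nat) \<Rightarrow> real" where
  "cont_expect f 0 k G q = G q"
| "cont_expect f (Suc i) k G q =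
     (\<Sum>j\<le>k. attach_prob f q k j * cont_expect f i (Suc k) G (q(Suc k := j)))"

text \<open>Events that can be read off the tree at time \<open>n\<close>. Index 0 is left out
  because node 0 has no parent.\<close>

definition determined :: "nat \<Rightarrow> ((nat \<Rightarrow> nat) \<Rightarrow> bool) \<Rightarrow> bool" where
  "determined n P \<longleftrightarrow> (\<forall>p p'. (\<forall>i\<in>{1..n}. p i = p' i) \<longrightarrow> P p = P p')"

text \<open>Parents precede their children. The process guarantees this only almost surely, see
  \<open>AE_valid_code\<close>.\<close>

definition valid_code :: "nat \<Rightarrow> (nat \<Rightarrow> nat) \<Rightarrow> bool" where
  "valid_code n p \<longleftrightarrow> (\<forall>i\<in>{1..n}. p i < i)"

definition max_deg :: "(nat \<Rightarrow> nat) \<Rightarrow> nat \<Rightarrow> nat" where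
  "max_deg p n = Max (outdeg p n ` {..n})"

definition leader :: "(nat \<Rightarrow> nat) \<Rightarrow> nat \<Rightarrow> nat" where
  "leader p n = (LEAST u. u \<le> n \<and> outdeg p n u = max_deg p n)"

section \<open>Deterministic facts about degrees, the maximal degree and the leader\<close>

lemma outdeg_cong:
  assumes "\<And>i. i \<in> {1..n} \<Longrightarrow> p i = p' i"
  shows "outdeg p n u = outdeg p' n u"
  unfolding outdeg_def by (rule arg_cong[where f = card]) (use assms in auto)

lemma max_deg_cong:
  assumes "\<And>i. i \<in> {1..n} \<Longrightarrow> p i = p' i"
  shows "max_deg p n = max_deg p' n"
proof -
  have "outdeg p n = outdeg p' n" by (rule ext) (rule outdeg_cong, rule assms)
  then show ?thesis by (simp add: max_deg_def)
qed

lemma leader_cong: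
  assumes "\<And>i. i \<in> {1..n} \<Longrightarrow> p i = p' i"
  shows "leader p n = leader p' n"
proof -
  have "outdeg p n = outdeg p' n" by (rule ext) (rule outdeg_cong, rule assms)
  then show ?thesis by (simp add: leader_def max_deg_def)
qed

lemma outdeg_upd_le: "i \<le> k \<Longrightarrow> outdeg (q(Suc k := j)) i u = outdeg q i u"
  by (rule outdeg_cong) auto

lemma outdeg_0 [simp]: "outdeg p 0 u = 0"
  by (simp add: outdeg_def)

lemma outdeg_Suc: "outdeg p (Suc k) u = outdeg p k u + of_bool (p (Suc k) = u)"
proof -
  have "{i \<in> {1..Suc k}. p i = u} =
      {i \<in> {1..k}. p i = u} \<union> (if p (Suc k) = u then {Suc k} else {})"
    by (auto simp: le_Suc_eq)
  moreover have "card ({i \<in> {1..k}. p i = u} \<union> (if p (Suc k) = u then {Suc k} else {}))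
      = card {i \<in> {1..k}. p i = u} + card (if p (Suc k) = u then {Suc k} else {})"
    by (rule card_Un_disjoint) auto
  ultimately show ?thesis by (auto simp: outdeg_def)
qed

lemma outdeg_upd: "outdeg (q(Suc k := j)) (Suc k) u = outdeg q k u + of_bool (j = u)"
  by (simp add: outdeg_Suc outdeg_upd_le)

lemma outdeg_mono: "m \<le> n \<Longrightarrow> outdeg p m u \<le> outdeg p n u"
  by (induction n rule: dec_induct) (auto simp: outdeg_Suc)

lemma outdeg_le: "outdeg p n u \<le> n"
  by (induction n) (auto simp: outdeg_Suc)

text \<open>Each of the \<open>n\<close> edges has exactly one tail, so it is counted at most
  once.\<close>

lemma sum_outdeg_le: "(\<Sum>u\<in>A. outdeg p n u) \<le> n"
proof (cases "finite A")
  case True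
  show ?thesis
  proof (induction n)
    case (Suc n)
    have "(\<Sum>u\<in>A. of_bool (p (Suc n) = u)) \<le> (1::nat)"
      using True by (simp add: of_bool_def)
    with Suc show ?case by (simp add: outdeg_Suc sum.distrib)
  qed simp
qed simp

lemma max_deg_ge: "u \<le> n \<Longrightarrow> outdeg p n u \<le> max_deg p n"
  unfolding max_deg_def by (rule Max_ge) auto

lemma leader_props: "leader p n \<le> n" "outdeg p n (leader p n) = max_deg p n"
proof -
  have "max_deg p n \<in> outdeg p n ` {..n}"
    unfolding max_deg_def by (rule Max_in) auto
  then have "\<exists>u. u \<le> n \<and> outdeg p n u = max_deg p n" by auto
  from LeastI_ex[OF this] show "leader p n \<le> n" "outdeg p n (leader p n) = max_deg p n"
    by (auto simp: leader_def)
qed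

lemma max_deg_mono:
  assumes "m \<le> n" shows "max_deg p m \<le> max_deg p n"
proof -
  have "max_deg p m \<le> outdeg p n (leader p m)"
    using outdeg_mono[OF assms, of p "leader p m"] leader_props(2)[of p m] by simp
  also have "\<dots> \<le> max_deg p n"
    using leader_props(1)[of p m] assms by (intro max_deg_ge) simp
  finally show ?thesis .
qed

text \<open>Node 1 can only be attached to node 0.\<close>

lemma max_deg_pos:
  assumes "valid_code n p" "1 \<le> n" shows "1 \<le> max_deg p n"
proof -
  have "p (Suc 0) = 0" using assms by (force simp: valid_code_def)
  then have "outdeg p (Suc 0) 0 = 1" by (simp add: outdeg_Suc)
  with max_deg_ge[of 0 1 p] max_deg_mono[of 1 n p] assms show ?thesis by simp
qed

lemma outdeg_newborn:
  assumes "valid_code n p" shows "outdeg p n n = 0"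
proof -
  have "p i \<noteq> n" if "i \<in> {1..n}" for i
    using assms that unfolding valid_code_def by fastforce
  then have "{i \<in> {1..n}. p i = n} = {}" by blast
  then show ?thesis by (simp only: outdeg_def card.empty)
qed

lemma valid_code_upd: "valid_code k q \<Longrightarrow> j \<le> k \<Longrightarrow> valid_code (Suc k) (q(Suc k := j))"
  by (auto simp: valid_code_def le_Suc_eq)

lemma determinedD: "determined n P \<Longrightarrow> (\<And>i. i \<in> {1..n} \<Longrightarrow> p i = p' i) \<Longrightarrow> P p = P p'"
  unfolding determined_def by blast

lemma determinedI:
  "(\<And>p p'. (\<And>i. i \<in> {1..n} \<Longrightarrow> p i = p' i) \<Longrightarrow> P p = P p') \<Longrightarrow> determined n P"
  unfolding determined_def by blast

lemma determined_upd:
  assumes "determined (Suc n) P" shows "determined n (\<lambda>p. P (p(Suc n := j)))"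
  by (rule determinedI, rule determinedD[OF assms]) (auto simp: le_Suc_eq)

section \<open>One-step transition probabilities and the expectation operator\<close>

locale attachment =
  fixes f :: "nat \<Rightarrow> real"
  assumes f_pos: "f i > 0"
begin

abbreviation ce where "ce \<equiv> cont_expect f"

lemma Zsum_pos: "Zsum f p n > 0"
  unfolding Zsum_def by (intro sum_pos f_pos) auto

lemma attach_prob_nonneg: "attach_prob f p k j \<ge> 0"
  using Zsum_pos[of p k] f_pos by (auto simp: attach_prob_def less_imp_le)

lemma sum_attach_prob: "(\<Sum>j\<le>k. attach_prob f p k j) = 1"
proof -
  have "(\<Sum>j\<le>k. attach_prob f p k j) = (\<Sum>j\<le>k. f (outdeg p k j)) / Zsum f p k"
    by (simp add: attach_prob_def sum_divide_distrib)
  then show ?thesis using Zsum_pos[of p k] by (simp add: Zsum_def)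
qed

text \<open>The comparison is required only on valid continuations of \<open>q\<close>, so that
  whatever is already decided by the history \<open>q\<close> may be used in it.\<close>

lemma ce_mono:
  assumes "valid_code k q"
    and "\<And>p. valid_code (k + i) p \<Longrightarrow> (\<forall>l\<le>k. p l = q l) \<Longrightarrow> G p \<le> G' p"
  shows "ce i k G q \<le> ce i k G' q"
  using assms
proof (induction i arbitrary: k q)
  case (Suc i)
  have "ce i (Suc k) G (q(Suc k := j)) \<le> ce i (Suc k) G' (q(Suc k := j))" if "j \<le> k" for j
  proof (rule Suc.IH)
    show "valid_code (Suc k) (q(Suc k := j))" by (rule valid_code_upd) fact+
    fix p assume "valid_code (Suc k + i) p" "\<forall>l\<le>Suc k. p l = (q(Suc k := j)) l"
    then show "G p \<le> G' p" by (intro Suc.prems) (auto split: if_splits)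
  qed
  then show ?case
    by (auto intro!: sum_mono mult_left_mono attach_prob_nonneg)
qed simp

lemma ce_const: "ce i k (\<lambda>_. c) q = c"
proof (induction i arbitrary: k q)
  case (Suc i)
  then show ?case by (simp add: sum_distrib_right[symmetric] sum_attach_prob)
qed simp

lemma ce_cmult: "ce i k (\<lambda>p. c * G p) q = c * ce i k G q"
  by (induction i arbitrary: k q) (simp_all add: sum_distrib_left mult_ac)

lemma ce_tower: "ce (i + j) k G q = ce i k (ce j (k + i) G) q"
  by (induction i arbitrary: k q) simp_all

end

section \<open>Transfer between the process and the expectation operator\<close>

locale gpa = attachment f + prob_space M
  for f :: "nat \<Rightarrow> real" and M :: "'a measure" +
  fixes X :: "'a \<Rightarrow> nat \<Rightarrow> nat"
  assumes tree: "gpa_tree M f X"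
begin

lemma X_measurable [measurable]: "(\<lambda>\<omega>. X \<omega> k) \<in> measurable M (count_space UNIV)"
  using tree by (simp add: gpa_tree_def)

definition cyl :: "nat \<Rightarrow> (nat \<Rightarrow> nat) \<Rightarrow> 'a set" where
  "cyl n q = {\<omega> \<in> space M. \<forall>k\<in>{1..n}. X \<omega> k = q k}"

lemma cyl_sets [measurable]: "cyl n q \<in> sets M"
  unfolding cyl_def by measurable

lemma prob_cyl: "prob (cyl n q) = (\<Prod>k<n. attach_prob f q k (q (Suc k)))"
  using tree by (simp add: gpa_tree_def cyl_def)

lemma attach_prob_cong:
  "(\<And>i. i \<in> {1..k} \<Longrightarrow> p i = p' i) \<Longrightarrow> attach_prob f p k j = attach_prob f p' k j"
  using outdeg_cong[of k p p'] by (simp add: attach_prob_def Zsum_def)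

lemma prob_cyl_upd: "prob (cyl (Suc n) (q(Suc n := j))) = prob (cyl n q) * attach_prob f q n j"
proof -
  have "attach_prob f (q(Suc n := j)) k = attach_prob f q k" if "k \<le> n" for k
    using that by (intro ext attach_prob_cong) auto
  then show ?thesis by (simp add: prob_cyl)
qed

text \<open>Splitting by the value of the last coordinate, which ranges over a countable set,
  freezes that coordinate and leaves an event determined one step earlier.\<close>

lemma determined_sets:
  "determined n P \<Longrightarrow> {\<omega> \<in> space M. P (X \<omega>)} \<in> sets M"
proof (induction n arbitrary: P)
  case 0
  then have "P p = P p'" for p p' by (intro determinedD[of 0 P]) auto
  then have "{\<omega> \<in> space M. P (X \<omega>)} = (if P undefined then space M else {})" by auto
  then show ?case by auto
next
  case (Suc n)
  have "{\<omega> \<in> space M. P (X \<omega>)} =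
      (\<Union>j. {\<omega> \<in> space M. X \<omega> (Suc n) = j} \<inter> {\<omega> \<in> space M. P ((X \<omega>)(Suc n := j))})"
    by auto
  moreover have "{\<omega> \<in> space M. P ((X \<omega>)(Suc n := j))} \<in> sets M" for j
    by (rule Suc.IH) (rule determined_upd, fact)
  moreover have "{\<omega> \<in> space M. X \<omega> (Suc n) = j} \<in> sets M" for j
    by measurable
  ultimately show ?case by (simp only:) (intro sets.countable_UN image_subsetI sets.Int)
qed

lemma cyl_Suc: "cyl (Suc n) (q(Suc n := j)) = {\<omega> \<in> cyl n q. X \<omega> (Suc n) = j}"
  by (auto simp: cyl_def le_Suc_eq)

text \<open>Identifies \<open>ce\<close> as a conditional expectation given the tree at time
  \<open>k\<close>. The product form also covers cylinders of probability 0.\<close>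

lemma prob_cyl_inter:
  assumes "determined (k + i) P"
  shows "prob (cyl k q \<inter> {\<omega> \<in> space M. P (X \<omega>)}) = prob (cyl k q) * ce i k (\<lambda>p. of_bool (P p)) q"
  using assms
proof (induction i arbitrary: k q)
  case 0
  have "P (X \<omega>) = P q" if "\<omega> \<in> cyl k q" for \<omega>
    using that 0 by (intro determinedD[of k P]) (auto simp: cyl_def)
  then have "cyl k q \<inter> {\<omega> \<in> space M. P (X \<omega>)} = (if P q then cyl k q else {})"
    by (auto simp: cyl_def)
  then show ?case by auto
next
  case (Suc i)
  let ?A = "{\<omega> \<in> space M. P (X \<omega>)}"
  let ?C = "\<lambda>j. cyl (Suc k) (q(Suc k := j))"
  have A: "?A \<in> sets M" using Suc.prems by (rule determined_sets)
  \<comment> \<open>Parents larger than \<open>k\<close> are not excluded pointwise; since the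
    attachment probabilities sum to 1, the admissible parents fill the cylinder up to a null
    set.\<close>
  let ?U = "\<Union>j\<in>{..k}. ?C j"
  have disj: "disjoint_family_on ?C {..k}"
    by (auto simp: disjoint_family_on_def cyl_Suc)
  have "prob ?U = (\<Sum>j\<le>k. prob (?C j))"
    by (rule finite_measure_finite_Union) (auto intro: disj)
  also have "\<dots> = prob (cyl k q)"
    by (simp add: prob_cyl_upd sum_distrib_left[symmetric] sum_attach_prob)
  finally have U: "prob ?U = prob (cyl k q)" .
  have sub: "?U \<subseteq> cyl k q" by (auto simp: cyl_Suc)
  have null: "prob (cyl k q - ?U) = 0"
    using U sub by (subst finite_measure_Diff) auto
  have "prob (cyl k q \<inter> ?A) = prob (?U \<inter> ?A)"
  proof (rule antisym)
    have "prob (cyl k q \<inter> ?A) \<le> prob ((?U \<inter> ?A) \<union> (cyl k q - ?U))"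
      using A by (intro finite_measure_mono) auto
    also have "\<dots> \<le> prob (?U \<inter> ?A) + prob (cyl k q - ?U)"
      using A by (intro measure_Un_le) auto
    finally show "prob (cyl k q \<inter> ?A) \<le> prob (?U \<inter> ?A)" using null by simp
    show "prob (?U \<inter> ?A) \<le> prob (cyl k q \<inter> ?A)"
      using A sub by (intro finite_measure_mono) auto
  qed
  also have "?U \<inter> ?A = (\<Union>j\<in>{..k}. ?C j \<inter> ?A)" by auto
  also have "prob \<dots> = (\<Sum>j\<le>k. prob (?C j \<inter> ?A))"
    using A disj by (intro finite_measure_finite_Union) (auto simp: disjoint_family_on_def)
  also have "\<dots> = (\<Sum>j\<le>k. prob (cyl k q) * (attach_prob f q k j *
      ce i (Suc k) (\<lambda>p. of_bool (P p)) (q(Suc k := j))))"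
    using Suc.prems by (subst Suc.IH) (auto simp: prob_cyl_upd mult_ac)
  finally show ?case by (simp add: sum_distrib_left)
qed

lemma prob_determined:
  assumes "determined n P"
  shows "prob {\<omega> \<in> space M. P (X \<omega>)} = ce n 0 (\<lambda>p. of_bool (P p)) (\<lambda>_. 0)"
proof -
  have "cyl 0 (\<lambda>_. 0) = space M" by (auto simp: cyl_def)
  with prob_cyl_inter[of 0 n P "\<lambda>_. 0"] assms show ?thesis
    by (simp add: prob_space Int_absorb1)
qed

text \<open>The operator \<open>ce\<close> branches only into parents at most \<open>k\<close>, so
  every code it reaches from the trivially valid start is valid.\<close>

lemma AE_valid_code: "AE \<omega> in M. \<forall>n. valid_code n (X \<omega>)"
  unfolding AE_all_countable
proof
  fix n
  have d: "determined n (valid_code n)"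
    by (simp add: determined_def valid_code_def)
  have "prob {\<omega> \<in> space M. valid_code n (X \<omega>)} = ce n 0 (\<lambda>p. of_bool (valid_code n p)) (\<lambda>_. 0)"
    by (rule prob_determined) fact
  moreover have "ce n 0 (\<lambda>_. 1) (\<lambda>_. 0) \<le> ce n 0 (\<lambda>p. of_bool (valid_code n p)) (\<lambda>_. 0)"
    by (rule ce_mono) (auto simp: valid_code_def)
  ultimately have "prob {\<omega> \<in> space M. valid_code n (X \<omega>)} = 1"
    using prob_le_1[of "{\<omega> \<in> space M. valid_code n (X \<omega>)}"] by (simp add: ce_const)
  from AE_prob_1[OF this] show "AE \<omega> in M. valid_code n (X \<omega>)" by eventually_elim simp
qed

text \<open>Continuity from below along an increasing sequence of events.\<close>

lemma prob_ex_le: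
  assumes "\<And>n. determined n (P n)" "\<And>n p. P n p \<Longrightarrow> P (Suc n) p"
    and "\<And>n. n \<ge> N \<Longrightarrow> ce n 0 (\<lambda>p. of_bool (P n p)) (\<lambda>_. 0) \<le> c"
  shows "prob {\<omega> \<in> space M. \<exists>n. P n (X \<omega>)} \<le> c"
proof -
  let ?A = "\<lambda>n. {\<omega> \<in> space M. P n (X \<omega>)}"
  have "(\<lambda>n. prob (?A n)) \<longlonglongrightarrow> prob (\<Union>n. ?A n)"
    using assms(1,2)
    by (intro finite_Lim_measure_incseq) (auto intro!: determined_sets incseq_SucI)
  moreover have "prob (?A n) \<le> c" if "n \<ge> N" for n
    using prob_determined[OF assms(1)] assms(3)[OF that] by simp
  moreover have "(\<Union>n. ?A n) = {\<omega> \<in> space M. \<exists>n. P n (X \<omega>)}" by auto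
  ultimately show ?thesis
    by (intro LIMSEQ_le_const2[of "\<lambda>n. prob (?A n)"]) auto
qed

end

section \<open>Races between two vertices\<close>

text \<open>The race moves from \<open>(a, b)\<close> to \<open>(Suc a, b)\<close> with probability
  \<open>f a / (f a + f b)\<close>; clearing the denominator gives this form. The region
  \<open>m \<le> a\<close> is never left, as degrees only grow.\<close>

definition race_superharmonic ::
  "(nat \<Rightarrow> real) \<Rightarrow> nat \<Rightarrow> (nat \<Rightarrow> nat \<Rightarrow> real) \<Rightarrow> bool" where
  "race_superharmonic f m H \<longleftrightarrow> (\<forall>a\<ge>m. \<forall>b.
     0 \<le> H a b \<and> f a * H (Suc a) b + f b * H a (Suc b) \<le> (f a + f b) * H a b)"

context attachment
begin

text \<open>A child of a third vertex leaves \<open>H\<close> unchanged, so the drift in the tree is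
  the drift of the race divided by \<open>Zsum\<close>.\<close>

lemma race_step:
  assumes "race_superharmonic f m H" "m \<le> outdeg q k u" "u \<noteq> v" "u \<le> k" "v \<le> k"
  shows "(\<Sum>j\<le>k. attach_prob f q k j *
      H (outdeg (q(Suc k := j)) (Suc k) u) (outdeg (q(Suc k := j)) (Suc k) v))
    \<le> H (outdeg q k u) (outdeg q k v)"
proof -
  define a b where "a = outdeg q k u" and "b = outdeg q k v"
  let ?P = "attach_prob f q k"
  have "(\<Sum>j\<le>k. ?P j *
      H (outdeg (q(Suc k := j)) (Suc k) u) (outdeg (q(Suc k := j)) (Suc k) v))
    = (\<Sum>j\<le>k. ?P j * H a b + (if j = u then ?P u * (H (Suc a) b - H a b) else 0)
        + (if j = v then ?P v * (H a (Suc b) - H a b) else 0))"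
    using \<open>u \<noteq> v\<close> by (intro sum.cong) (auto simp: outdeg_upd a_def b_def algebra_simps)
  also have "\<dots> = H a b + ?P u * (H (Suc a) b - H a b) + ?P v * (H a (Suc b) - H a b)"
    using assms by (simp add: sum.distrib sum_distrib_right[symmetric] sum_attach_prob)
  also have "\<dots> = H a b + (f a * H (Suc a) b + f b * H a (Suc b) - (f a + f b) * H a b) / Zsum f q k"
    using assms by (simp add: attach_prob_def a_def b_def diff_divide_distrib add_divide_distrib
        algebra_simps)
  also have "\<dots> \<le> H a b"
    using assms Zsum_pos[of q k]
    by (auto simp: race_superharmonic_def a_def intro!: divide_nonpos_pos)
  finally show ?thesis by (simp add: a_def b_def)
qed

lemma ce_of_bool_le_1: "ce i k (\<lambda>p. of_bool (P p)) q \<le> 1"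
proof (induction i arbitrary: k q)
  case (Suc i)
  have "ce (Suc i) k (\<lambda>p. of_bool (P p)) q \<le> (\<Sum>j\<le>k. attach_prob f q k j * 1)"
    unfolding cont_expect.simps by (intro sum_mono mult_left_mono Suc attach_prob_nonneg)
  then show ?case by (simp add: sum_attach_prob)
qed simp

text \<open>Optional stopping at the first tie satisfying \<open>B\<close>, by induction on the
  remaining time. Only ties of degree at most \<open>k + i\<close> matter, since no degree exceeds
  the time.\<close>

lemma tie_bound:
  assumes "race_superharmonic f m H" "u \<noteq> v" "u \<le> k" "v \<le> k" "valid_code k q"
    and "m \<le> outdeg q k u"
    and "\<And>x. m \<le> x \<Longrightarrow> x \<le> k + i \<Longrightarrow> B x \<Longrightarrow> 1 \<le> H x x"
  shows "ce i k (\<lambda>p. of_bool (\<exists>t\<in>{k..k + i}. outdeg p t u = outdeg p t v \<and> B (outdeg p t u))) q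
    \<le> H (outdeg q k u) (outdeg q k v)"
  using assms(3-)
proof (induction i arbitrary: k q)
  case 0
  then show ?case using assms(1) outdeg_le[of q k u]
    by (auto simp: race_superharmonic_def of_bool_def)
next
  case (Suc i)
  let ?tie = "\<lambda>p t. outdeg p t u = outdeg p t v \<and> B (outdeg p t u)"
  show ?case
  proof (cases "?tie q k")
    case True
    then have "1 \<le> H (outdeg q k u) (outdeg q k v)"
      using Suc.prems outdeg_le[of q k u] by auto
    then show ?thesis using ce_of_bool_le_1 by (rule order_trans[rotated])
  next
    case False
    have "ce i (Suc k) (\<lambda>p. of_bool (\<exists>t\<in>{k..k + Suc i}. ?tie p t)) (q(Suc k := j))
      \<le> H (outdeg (q(Suc k := j)) (Suc k) u) (outdeg (q(Suc k := j)) (Suc k) v)" (is "?L \<le> ?R")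
      if j: "j \<le> k" for j
    proof -
      have "?L \<le> ce i (Suc k) (\<lambda>p. of_bool (\<exists>t\<in>{Suc k..Suc k + i}. ?tie p t)) (q(Suc k := j))"
      proof (rule ce_mono)
        fix p assume p: "\<forall>l\<le>Suc k. p l = (q(Suc k := j)) l"
        have "outdeg p k = outdeg q k" by (rule ext, rule outdeg_cong) (use p in auto)
        with False have "\<not> ?tie p k" by simp
        then have "(\<exists>t\<in>{k..k + Suc i}. ?tie p t) \<Longrightarrow> (\<exists>t\<in>{Suc k..Suc k + i}. ?tie p t)"
          by (metis add_Suc_right add_Suc_shift atLeastAtMost_iff le_antisym not_less_eq_eq)
        then show "of_bool (\<exists>t\<in>{k..k + Suc i}. ?tie p t)
          \<le> (of_bool (\<exists>t\<in>{Suc k..Suc k + i}. ?tie p t) :: real)" by simp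
      qed (use Suc.prems j in \<open>auto intro: valid_code_upd\<close>)
      also have "\<dots> \<le> ?R"
        using Suc.prems j by (intro Suc.IH[of "Suc k" "q(Suc k := j)"] valid_code_upd) (auto simp: outdeg_upd simp del: fun_upd_apply)
      finally show ?thesis .
    qed
    then have "ce (Suc i) k (\<lambda>p. of_bool (\<exists>t\<in>{k..k + Suc i}. ?tie p t)) q
      \<le> (\<Sum>j\<le>k. attach_prob f q k j *
          H (outdeg (q(Suc k := j)) (Suc k) u) (outdeg (q(Suc k := j)) (Suc k) v))"
      unfolding cont_expect.simps by (intro sum_mono mult_left_mono attach_prob_nonneg) auto
    also have "\<dots> \<le> H (outdeg q k u) (outdeg q k v)"
      using assms(1,2) Suc.prems by (intro race_step) auto
    finally show ?thesis .
  qed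
qed

end

section \<open>Newcomers and the maximal degree\<close>

text \<open>Weierstrass' product inequality.\<close>

lemma prod_one_minus_ge:
  fixes x :: "'b \<Rightarrow> real"
  assumes "finite A" "\<And>i. i \<in> A \<Longrightarrow> 0 \<le> x i \<and> x i \<le> 1"
  shows "1 - (\<Sum>i\<in>A. x i) \<le> (\<Prod>i\<in>A. 1 - x i)"
  using assms
proof (induction A rule: finite_induct)
  case (insert a A)
  have "(\<Prod>i\<in>A. 1 - x i) \<le> 1" using insert by (intro prod_le_1) auto
  then have "x a * (\<Prod>i\<in>A. 1 - x i) \<le> x a" using insert by (simp add: mult_left_le)
  with insert show ?case by (simp add: algebra_simps)
qed simp

lemma sum_inverse_squares_le:
  assumes "1 \<le> m"
  shows "(\<Sum>i=m..<n. 1 / real (i + 1) ^ 2) \<le> 1 / real m"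
proof (cases "m \<le> n")
  case True
  \<comment> \<open>Comparison with the telescoping terms \<open>1 / (i * (i + 1))\<close>.\<close>
  have "(\<Sum>i=m..<n. 1 / real (i + 1) ^ 2) \<le> (\<Sum>i=m..<n. 1 / real i - 1 / real (Suc i))"
  proof (intro sum_mono)
    fix i assume "i \<in> {m..<n}"
    then have "0 < real i" using assms by simp
    then have "1 / real i - 1 / real (Suc i) = 1 / (real i * real (i + 1))"
      by (simp add: field_simps)
    also have "\<dots> \<ge> 1 / real (i + 1) ^ 2"
      using \<open>0 < real i\<close> unfolding power2_eq_square
      by (intro divide_left_mono mult_right_mono mult_pos_pos) auto
    finally show "1 / real (i + 1) ^ 2 \<le> 1 / real i - 1 / real (Suc i)" .
  qed
  also have "\<dots> = - (\<Sum>i=m..<n. 1 / real (Suc i) - 1 / real i)"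
    by (simp add: sum_negf[symmetric])
  also have "\<dots> = 1 / real m - 1 / real n"
    using sum_Suc_diff'[of m n "\<lambda>i. 1 / real i"] True by simp
  finally show ?thesis by (simp add: order_trans)
qed simp

lemma prod_one_plus_eq_binomial:
  "(\<Prod>i<m. 1 + real r / real (i + 1)) = real ((m + r) choose r)"
proof (induction m)
  case (Suc m)
  have "Suc m * (Suc (m + r) choose Suc m) = Suc (m + r) * ((m + r) choose m)"
    by (rule Suc_times_binomial)
  moreover have "Suc (m + r) choose Suc m = (Suc m + r) choose r" "(m + r) choose m = (m + r) choose r"
    using binomial_symmetric[of "Suc m" "Suc (m + r)"] binomial_symmetric[of m "m + r"] by auto
  ultimately have "Suc m * ((Suc m + r) choose r) = (Suc m + r) * ((m + r) choose r)" by simp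
  then have "real (Suc m) * real ((Suc m + r) choose r) = real (Suc m + r) * real ((m + r) choose r)"
    by (metis of_nat_mult)
  then have "real ((Suc m + r) choose r) = real (Suc m + r) / real (Suc m) * real ((m + r) choose r)"
    by (simp add: field_simps)
  with Suc show ?case by (simp add: field_simps)
qed simp

text \<open>Reciprocal of the product of \<open>1 + r / (i + 1)\<close> over \<open>i < m\<close>,
  hence of order \<open>m powr - r\<close> for fixed \<open>r\<close>, but with the exact recursion
  \<open>decay_Suc\<close>.\<close>

definition decay :: "nat \<Rightarrow> nat \<Rightarrow> real" where
  "decay r m = 1 / real ((m + r) choose r)"

lemma decay_pos: "decay r m > 0"
  by (simp add: decay_def)

lemma decay_Suc: "decay r (Suc m) = decay r m * (1 - real r / real (m + r + 1))"
proof -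
  have "decay r (Suc m) = decay r m / (1 + real r / real (m + 1))"
    unfolding decay_def prod_one_plus_eq_binomial[symmetric] by simp
  then show ?thesis by (simp add: field_simps)
qed

lemma decay_antimono: "m \<le> n \<Longrightarrow> decay r n \<le> decay r m"
proof (induction n rule: dec_induct)
  case (step n)
  have "decay r (Suc n) \<le> decay r n * 1"
    unfolding decay_Suc using decay_pos[of r n] by (intro mult_left_mono) auto
  with step show ?case by simp
qed simp

lemma decay_le_1: "decay r m \<le> 1"
  using decay_antimono[of 0 m r] by (simp add: decay_def)

lemma decay_1: "decay 1 m = 1 / real (m + 1)"
  by (simp add: decay_def)

section \<open>Consequences of the growth condition\<close>

locale linear_attachment = attachment f for f +
  fixes \<kappa> :: real
  assumes growth: "i \<le> n \<Longrightarrow> f i / real (i + 1) \<le> \<kappa> * (f n / real (n + 1))"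
begin

lemma kappa_ge_1: "1 \<le> \<kappa>"
  using growth[of 0 0] f_pos[of 0] by simp

lemma f_le: "i \<le> n \<Longrightarrow> f i \<le> \<kappa> * f n / real (n + 1) * real (i + 1)"
  using growth[of i n] by (simp add: field_simps)

lemma newcomer_bound:
  assumes m: "real m \<ge> 2 * real r ^ 2 * \<kappa> ^ 4" "1 \<le> m"
    and "u \<noteq> v" "u \<le> k" "v \<le> k" "valid_code k q" "outdeg q k u = m" "outdeg q k v = 0"
  shows "ce i k (\<lambda>p. of_bool (\<exists>t\<in>{k..k + i}. outdeg p t u = outdeg p t v)) q \<le> 2 * decay r m"
proof -
  \<comment> \<open>The factor \<open>\<kappa>\<close> makes \<open>l / f i\<close> at least
    \<open>r / (i + 1)\<close> below \<open>m\<close>, where the product has to outweigh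
    \<open>decay r m\<close>. From \<open>m\<close> on, the growth condition still gives the upper
    bound \<open>r * \<kappa> ^ 2 / (i + 1)\<close>.\<close>
  define l where "l = \<kappa> * real r * f m / real (m + 1)"
  define H where "H a b = 2 * decay r m * (\<Prod>i<b. 1 + l / f i) * (\<Prod>i=m..<a. 1 - l / f i)" for a b
  have l0: "0 \<le> l" using kappa_ge_1 f_pos[of m] by (simp add: l_def)
  have ub: "l / f i \<le> real r * \<kappa> ^ 2 / real (i + 1)" if "m \<le> i" for i
  proof -
    have "l / f i * real (i + 1) = \<kappa> * real r * (f m / real (m + 1)) * real (i + 1) / f i"
      by (simp add: l_def)
    also have "\<dots> \<le> \<kappa> * real r * (\<kappa> * (f i / real (i + 1))) * real (i + 1) / f i"
      using growth[OF that] kappa_ge_1 f_pos[of i]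
      by (intro divide_right_mono mult_right_mono mult_left_mono) auto
    also have "\<dots> = real r * \<kappa> ^ 2" using f_pos[of i] by (simp add: power2_eq_square)
    finally show ?thesis by (simp add: pos_le_divide_eq)
  qed
  have lb: "real r / real (i + 1) \<le> l / f i" if "i < m" for i
  proof -
    have "f i * real r \<le> \<kappa> * f m / real (m + 1) * real (i + 1) * real r"
      using f_le[of i m] that by (intro mult_right_mono) auto
    then have "real r * f i \<le> l * real (i + 1)" by (simp add: l_def mult_ac)
    then show ?thesis using f_pos[of i] by (simp add: frac_le_eq divide_simps mult_ac)
  qed
  \<comment> \<open>These squares are the loss at ties. By the lower bound on \<open>m\<close> they
    sum to at most 1/2 over \<open>i \<ge> m\<close>, which the factor 2 in \<open>H\<close>
    compensates; they also keep each \<open>1 - l / f i\<close> nonnegative.\<close>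
  have sq: "(l / f i)\<^sup>2 \<le> real r ^ 2 * \<kappa> ^ 4 * (1 / real (i + 1) ^ 2)" if "m \<le> i" for i
  proof -
    have "(l / f i)\<^sup>2 \<le> (real r * \<kappa> ^ 2 / real (i + 1))\<^sup>2"
      using l0 f_pos[of i] by (intro power_mono ub that) (auto intro: divide_nonneg_pos)
    then show ?thesis by (simp add: power_divide power_mult_distrib)
  qed
  have lt1: "l / f i \<le> 1" if "m \<le> i" for i
  proof -
    have "(l / f i)\<^sup>2 \<le> real r ^ 2 * \<kappa> ^ 4 * (1 / real (i + 1) ^ 2)" using sq that .
    also have "\<dots> \<le> real m * (1 / real (i + 1) ^ 2)"
      using m zero_le_power[of \<kappa> 4] kappa_ge_1 by (intro mult_right_mono) (auto intro: order_trans[rotated])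
    also have "\<dots> \<le> real (i + 1) ^ 2 * (1 / real (i + 1) ^ 2)"
      using that self_le_power[of "real (i + 1)" 2] by (intro mult_right_mono) auto
    also have "\<dots> = 1" by (simp del: of_nat_add)
    finally show ?thesis using power2_le_imp_le[of "l / f i" 1] by simp
  qed
  have nonneg: "0 \<le> H a b" for a b
    unfolding H_def using decay_pos[of r m] l0 f_pos lt1
    by (intro mult_nonneg_nonneg prod_nonneg) (auto simp: less_imp_le intro!: add_nonneg_nonneg)
  have "race_superharmonic f m H"
    unfolding race_superharmonic_def
  proof (intro allI impI conjI nonneg)
    fix a b assume "m \<le> a"
    then have "H (Suc a) b = H a b * (1 - l / f a)" "H a (Suc b) = H a b * (1 + l / f b)"
      by (simp_all add: H_def prod.atLeastLessThan_Suc)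
    then show "f a * H (Suc a) b + f b * H a (Suc b) \<le> (f a + f b) * H a b"
      using f_pos[of a] f_pos[of b] by (simp add: field_simps)
  qed
  moreover have "1 \<le> H x x" if "m \<le> x" for x
  proof -
    have "(\<Prod>i<x. 1 + l / f i) = (\<Prod>i<m. 1 + l / f i) * (\<Prod>i=m..<x. 1 + l / f i)"
      using that prod.atLeastLessThan_concat[of 0 m x "\<lambda>i. 1 + l / f i"]
      by (simp add: lessThan_atLeast0)
    then have "H x x = 2 * decay r m * (\<Prod>i<m. 1 + l / f i) *
        (\<Prod>i=m..<x. (1 + l / f i) * (1 - l / f i))"
      by (simp add: H_def prod.distrib)
    also have "(\<Prod>i=m..<x. (1 + l / f i) * (1 - l / f i)) = (\<Prod>i=m..<x. 1 - (l / f i)\<^sup>2)"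
      by (intro prod.cong) (auto simp: algebra_simps power2_eq_square)
    finally have Hx: "H x x = 2 * decay r m * (\<Prod>i<m. 1 + l / f i) * (\<Prod>i=m..<x. 1 - (l / f i)\<^sup>2)" .
    have "(\<Sum>i=m..<x. (l / f i)\<^sup>2) \<le> real r ^ 2 * \<kappa> ^ 4 * (\<Sum>i=m..<x. 1 / real (i + 1) ^ 2)"
      unfolding sum_distrib_left by (intro sum_mono sq) auto
    also have "\<dots> \<le> real r ^ 2 * \<kappa> ^ 4 * (1 / real m)"
      using m by (intro mult_left_mono sum_inverse_squares_le) auto
    also have "\<dots> \<le> 1 / 2" using m by (simp add: field_simps)
    finally have "1 / 2 \<le> 1 - (\<Sum>i=m..<x. (l / f i)\<^sup>2)" by simp
    also have "\<dots> \<le> (\<Prod>i=m..<x. 1 - (l / f i)\<^sup>2)"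
      using lt1 l0 f_pos by (intro prod_one_minus_ge) (auto simp: power_le_one less_imp_le)
    finally have half: "1 / 2 \<le> (\<Prod>i=m..<x. 1 - (l / f i)\<^sup>2)" .
    have "1 = decay r m * (\<Prod>i<m. 1 + real r / real (i + 1))"
      unfolding decay_def prod_one_plus_eq_binomial by simp
    also have "\<dots> \<le> decay r m * (\<Prod>i<m. 1 + l / f i)"
      using decay_pos[of r m] lb by (intro mult_left_mono prod_mono) (auto simp: add_nonneg_nonneg)
    finally have "1 \<le> decay r m * (\<Prod>i<m. 1 + l / f i)" .
    then have "1 * (1 / 2) \<le> (decay r m * (\<Prod>i<m. 1 + l / f i)) * (\<Prod>i=m..<x. 1 - (l / f i)\<^sup>2)"
      using half by (intro mult_mono) linarith+
    then show ?thesis unfolding Hx by linarith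
  qed
  ultimately have "ce i k (\<lambda>p. of_bool (\<exists>t\<in>{k..k + i}. outdeg p t u = outdeg p t v \<and> True)) q
    \<le> H (outdeg q k u) (outdeg q k v)"
    using assms by (intro tie_bound[where m = m]) auto
  \<comment> \<open>Both products are empty at the starting point \<open>(m, 0)\<close>.\<close>
  then show ?thesis using assms by (simp add: H_def)
qed

text \<open>Growth bounds the weight of each vertex by the leader's weight times a linear function
  of its own degree. The degrees sum to at most \<open>k\<close> over \<open>k + 1\<close> vertices,
  whence \<open>2 * k + 1\<close>.\<close>

lemma leader_attach_prob:
  "attach_prob f q k (leader q k) \<ge> real (max_deg q k + 1) / (\<kappa> * real (2 * k + 1))"
proof -
  define m where "m = max_deg q k"
  have "Zsum f q k \<le> (\<Sum>j\<le>k. \<kappa> * f m / real (m + 1) * real (outdeg q k j + 1))"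
    unfolding Zsum_def m_def by (intro sum_mono f_le max_deg_ge) auto
  also have "\<dots> = \<kappa> * f m / real (m + 1) * (real (\<Sum>j\<le>k. outdeg q k j) + real (k + 1))"
    unfolding sum_distrib_left[symmetric] by (simp add: sum.distrib)
  also have "\<dots> \<le> \<kappa> * f m / real (m + 1) * real (2 * k + 1)"
    using kappa_ge_1 f_pos[of m] sum_outdeg_le[of q k "{..k}"]
    by (intro mult_left_mono) (auto simp del: of_nat_sum)
  finally have Z: "Zsum f q k \<le> \<kappa> * f m / real (m + 1) * real (2 * k + 1)" .
  define D where "D = \<kappa> * real (2 * k + 1)"
  have "D > 0" using kappa_ge_1 by (simp add: D_def)
  then have "real (m + 1) / D = f m / (D * f m / real (m + 1))"
    using f_pos[of m] by (simp add: field_simps)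
  then have "real (m + 1) / (\<kappa> * real (2 * k + 1)) = f m / (\<kappa> * f m / real (m + 1) * real (2 * k + 1))"
    by (simp add: D_def mult_ac)
  also have "\<dots> \<le> f m / Zsum f q k"
    using Z Zsum_pos[of q k] f_pos[of m] kappa_ge_1 by (intro divide_left_mono mult_pos_pos) auto
  finally show ?thesis
    using leader_props[of q k] by (simp add: attach_prob_def m_def)
qed

text \<open>Only the gain when the leader itself receives the child is counted; otherwise
  monotonicity of the maximal degree suffices.\<close>

lemma decay_step:
  fixes q k r defines "m \<equiv> max_deg q k"
  shows "(\<Sum>j\<le>k. attach_prob f q k j * decay r (max_deg (q(Suc k := j)) (Suc k)))
    \<le> decay r m * (1 - real (m + 1) * real r / (real (m + r + 1) * \<kappa> * real (2 * k + 1)))"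
proof -
  let ?P = "attach_prob f q k" and ?u = "leader q k"
  let ?c = "real r / real (m + r + 1)"
  have u: "?u \<le> k" "outdeg q k ?u = m" using leader_props[of q k] by (auto simp: m_def)
  have ge: "m + of_bool (j = ?u) \<le> max_deg (q(Suc k := j)) (Suc k)" for j
    using max_deg_ge[of ?u "Suc k" "q(Suc k := j)"] u by (simp add: outdeg_upd)
  have "(\<Sum>j\<le>k. ?P j * decay r (max_deg (q(Suc k := j)) (Suc k)))
      \<le> (\<Sum>j\<le>k. ?P j * decay r (m + of_bool (j = ?u)))"
    by (intro sum_mono mult_left_mono decay_antimono ge attach_prob_nonneg)
  also have "\<dots> = (\<Sum>j\<le>k. ?P j * decay r m - (if j = ?u then ?P ?u * (decay r m * ?c) else 0))"
    by (intro sum.cong) (auto simp: decay_Suc algebra_simps)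
  also have "\<dots> = decay r m - ?P ?u * (decay r m * ?c)"
    using u by (simp add: sum_subtractf sum_distrib_right[symmetric] sum_attach_prob)
  also have "\<dots> \<le> decay r m - real (m + 1) / (\<kappa> * real (2 * k + 1)) * (decay r m * ?c)"
    using leader_attach_prob[of q k] decay_pos[of r m]
    by (intro diff_left_mono mult_right_mono mult_nonneg_nonneg) (auto simp: m_def)
  also have "\<dots> = decay r m * (1 - real (m + 1) * real r / (real (m + r + 1) * \<kappa> * real (2 * k + 1)))"
    by (simp add: algebra_simps)
  finally show ?thesis .
qed

text \<open>Each step costs at least a factor \<open>1 - 2 / (k + 1) = (k - 1) / (k + 1)\<close>,
  and these factors telescope. The resulting quadratic decay is summable, as Borel-Cantelli
  requires.\<close>

lemma decay_expect_quadratic: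
  assumes "2 \<le> k" "r \<le> max_deg q k" "real r \<ge> 8 * \<kappa>"
  shows "ce i k (\<lambda>p. decay r (max_deg p (k + i))) q
    \<le> decay r (max_deg q k) * (real k * real (k - 1) / (real (k + i) * real (k + i - 1)))"
  using assms
proof (induction i arbitrary: k q)
  case (Suc i)
  let ?w = "\<lambda>k. real k * real (k - 1)"
  let ?m = "max_deg q k"
  have "ce (Suc i) k (\<lambda>p. decay r (max_deg p (k + Suc i))) q
    \<le> (\<Sum>j\<le>k. attach_prob f q k j * (decay r (max_deg (q(Suc k := j)) (Suc k)) *
        (?w (Suc k) / ?w (Suc k + i))))"
    unfolding cont_expect.simps
  proof (intro sum_mono mult_left_mono attach_prob_nonneg)
    fix j
    have "max_deg q k = max_deg (q(Suc k := j)) k" by (rule max_deg_cong) auto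
    also have "\<dots> \<le> max_deg (q(Suc k := j)) (Suc k)" by (rule max_deg_mono) simp
    finally have "r \<le> max_deg (q(Suc k := j)) (Suc k)" using Suc.prems by simp
    with Suc.IH[of "Suc k" "q(Suc k := j)"] Suc.prems
    show "ce i (Suc k) (\<lambda>p. decay r (max_deg p (k + Suc i))) (q(Suc k := j))
      \<le> decay r (max_deg (q(Suc k := j)) (Suc k)) * (?w (Suc k) / ?w (Suc k + i))"
      by (simp del: fun_upd_apply)
  qed
  also have "\<dots> = (\<Sum>j\<le>k. attach_prob f q k j * decay r (max_deg (q(Suc k := j)) (Suc k))) *
      (?w (Suc k) / ?w (Suc k + i))"
    by (simp only: sum_distrib_right mult.assoc)
  also have "\<dots> \<le> (decay r ?m * (1 - 2 / real (k + 1))) * (?w (Suc k) / ?w (Suc k + i))"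
  proof (intro mult_right_mono)
    \<comment> \<open>As \<open>r \<le> ?m\<close>, the sum \<open>?m + r + 1\<close> is at most
      \<open>2 * (?m + 1)\<close>; one factor 2 of the 8 is spent here, the others give
      \<open>4 / (2 * k + 1)\<close>.\<close>
    have "8 * \<kappa> * real (?m + r + 1) \<le> real r * real (?m + r + 1)"
      using Suc.prems by (intro mult_right_mono) auto
    also have "\<dots> \<le> 2 * (real (?m + 1) * real r)"
      using Suc.prems mult_left_mono[of "real r" "real ?m" "real r"] by (simp add: algebra_simps)
    finally have a: "4 * \<kappa> * real (?m + r + 1) \<le> real (?m + 1) * real r" by linarith
    have "2 / real (k + 1) \<le> 4 / real (2 * k + 1)" by (simp add: field_simps)
    also have "\<dots> = 4 * \<kappa> * real (?m + r + 1) / (real (?m + r + 1) * \<kappa> * real (2 * k + 1))"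
    proof -
      have "4 / N = 4 * \<kappa> * A / (A * \<kappa> * N)" if "A > 0" "N > 0" for A N
        using kappa_ge_1 that by (simp add: field_simps)
      from this[of "real (?m + r + 1)" "real (2 * k + 1)"] show ?thesis by linarith
    qed
    also have "\<dots> \<le> real (?m + 1) * real r / (real (?m + r + 1) * \<kappa> * real (2 * k + 1))"
      using kappa_ge_1 by (intro divide_right_mono a) auto
    finally have "decay r ?m * (1 - real (?m + 1) * real r / (real (?m + r + 1) * \<kappa> * real (2 * k + 1)))
      \<le> decay r ?m * (1 - 2 / real (k + 1))"
      using decay_pos[of r ?m] by (intro mult_left_mono) auto
    with decay_step[of q k r]
    show "(\<Sum>j\<le>k. attach_prob f q k j * decay r (max_deg (q(Suc k := j)) (Suc k)))
      \<le> decay r ?m * (1 - 2 / real (k + 1))" by linarith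
  qed auto
  also have "(decay r ?m * (1 - 2 / real (k + 1))) * (?w (Suc k) / ?w (Suc k + i))
      = decay r ?m * (((1 - 2 / real (k + 1)) * ?w (Suc k)) / ?w (Suc k + i))"
    by simp
  also have "(1 - 2 / real (k + 1)) * ?w (Suc k) = ?w k"
    using Suc.prems by (simp add: field_simps of_nat_diff)
  finally show ?case by simp
qed (auto simp: decay_pos less_imp_le)

text \<open>For \<open>r = 1\<close> the ratio \<open>(m + 1) / (m + 2)\<close> is at least 1/2 for
  every degree \<open>m\<close>, so no initial size is assumed. The decay is slower but starts at
  time 0.\<close>

lemma decay_1_expect:
  "ce i k (\<lambda>p. decay 1 (max_deg p (k + i))) q
    \<le> decay 1 (max_deg q k) * exp (- (\<Sum>j=k..<k + i. 1 / (2 * \<kappa> * real (2 * j + 1))))"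
proof (induction i arbitrary: k q)
  case (Suc i)
  let ?s = "\<lambda>k. \<Sum>j=k..<k + i. 1 / (2 * \<kappa> * real (2 * j + 1))"
  let ?m = "max_deg q k"
  let ?c = "1 / (2 * \<kappa> * real (2 * k + 1))"
  have "ce (Suc i) k (\<lambda>p. decay 1 (max_deg p (k + Suc i))) q
    \<le> (\<Sum>j\<le>k. attach_prob f q k j * (decay 1 (max_deg (q(Suc k := j)) (Suc k)) * exp (- ?s (Suc k))))"
    unfolding cont_expect.simps
    using Suc.IH[of "Suc k"] by (intro sum_mono mult_left_mono attach_prob_nonneg) simp
  also have "\<dots> = (\<Sum>j\<le>k. attach_prob f q k j * decay 1 (max_deg (q(Suc k := j)) (Suc k))) *
      exp (- ?s (Suc k))"
    by (simp add: sum_distrib_right mult.assoc)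
  also have "\<dots> \<le> decay 1 ?m * exp (- ?c) * exp (- ?s (Suc k))"
  proof (intro mult_right_mono)
    define D where "D = \<kappa> * real (2 * k + 1)"
    have "?c = 1 / (2 * D)" by (simp add: D_def)
    also have "\<dots> = real (?m + 2) / 2 / (real (?m + 2) * D)"
      using kappa_ge_1 by (simp add: D_def)
    also have "\<dots> = real (?m + 2) / 2 / (real (?m + 2) * \<kappa> * real (2 * k + 1))"
      by (simp add: D_def mult_ac)
    also have "\<dots> \<le> real (?m + 1) / (real (?m + 2) * \<kappa> * real (2 * k + 1))"
      using kappa_ge_1 by (intro divide_right_mono) auto
    finally have "1 - real (?m + 1) / (real (?m + 2) * \<kappa> * real (2 * k + 1)) \<le> 1 - ?c" by simp
    also have "\<dots> \<le> exp (- ?c)" using exp_ge_add_one_self[of "- ?c"] by simp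
    finally have "decay 1 ?m * (1 - real (?m + 1) / (real (?m + 2) * \<kappa> * real (2 * k + 1)))
      \<le> decay 1 ?m * exp (- ?c)"
      using decay_pos[of 1 ?m] by (intro mult_left_mono) auto
    with decay_step[of q k 1]
    show "(\<Sum>j\<le>k. attach_prob f q k j * decay 1 (max_deg (q(Suc k := j)) (Suc k)))
      \<le> decay 1 ?m * exp (- ?c)" by simp
  qed auto
  also have "\<dots> = decay 1 ?m * exp (- (?c + ?s (Suc k)))"
    by (simp add: exp_add[symmetric])
  also have "?c + ?s (Suc k) = (\<Sum>j=k..<k + Suc i. 1 / (2 * \<kappa> * real (2 * j + 1)))"
    by (subst sum.atLeast_Suc_lessThan[of k "k + Suc i"]) auto
  finally show ?case .
qed simp

text \<open>The exponent is a multiple of the sum of \<open>1 / (2 * j + 1)\<close>, which diverges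
  with the harmonic series.\<close>

lemma decay_1_expect_tendsto: "(\<lambda>n. ce n 0 (\<lambda>p. decay 1 (max_deg p n)) q) \<longlonglongrightarrow> 0"
proof -
  let ?s = "\<lambda>n. \<Sum>j<n. 1 / (2 * \<kappa> * real (2 * j + 1))"
  have "\<not> summable (\<lambda>j. 1 / (2 * \<kappa> * real (2 * j + 1)))"
  proof
    assume "summable (\<lambda>j. 1 / (2 * \<kappa> * real (2 * j + 1)))"
    then have "summable (\<lambda>j. 4 * \<kappa> * (1 / (2 * \<kappa> * real (2 * j + 1))))" by (rule summable_mult)
    then have "summable (\<lambda>j. inverse (real (Suc j)))"
    proof (rule summable_comparison_test'[where N = 0])
      fix j
      have "4 * \<kappa> * (1 / (2 * \<kappa> * real (2 * j + 1))) = 2 / real (2 * j + 1)"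
      proof -
        have "4 * \<kappa> * (1 / (2 * \<kappa> * N)) = 2 / N" if "N > 0" for N
          using kappa_ge_1 that by (simp add: field_simps)
        from this[of "real (2 * j + 1)"] show ?thesis by simp
      qed
      also have "\<dots> \<ge> inverse (real (Suc j))" by (simp add: divide_simps)
      finally show "norm (inverse (real (Suc j))) \<le> 4 * \<kappa> * (1 / (2 * \<kappa> * real (2 * j + 1)))"
        by simp
    qed
    then show False
      using not_summable_harmonic[where 'a = real] summable_Suc_iff[of "\<lambda>j. inverse (real j)"] by auto
  qed
  moreover have pos: "0 \<le> 1 / (2 * \<kappa> * real (2 * j + 1))" for j
    using kappa_ge_1 by simp
  ultimately have unbounded: "\<exists>n. Z < ?s n" for Z
    using summableI_nonneg_bounded[of "\<lambda>j. 1 / (2 * \<kappa> * real (2 * j + 1))" Z] not_le by blast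
  have "filterlim ?s at_top sequentially"
    unfolding filterlim_at_top eventually_sequentially
  proof
    fix Z
    obtain n0 where "Z < ?s n0" using unbounded by blast
    moreover have "?s n0 \<le> ?s n" if "n0 \<le> n" for n
      using that pos by (intro sum_mono2) auto
    ultimately show "\<exists>N. \<forall>n\<ge>N. Z \<le> ?s n" by (meson less_imp_le order_trans)
  qed
  then have lim: "(\<lambda>n. exp (- ?s n)) \<longlonglongrightarrow> 0"
    by (intro filterlim_compose[OF exp_at_bot] filterlim_compose[OF filterlim_uminus_at_bot_at_top])
  have lo: "0 \<le> ce n 0 (\<lambda>p. decay 1 (max_deg p n)) q" for n
    using ce_mono[of 0 q n "\<lambda>_. 0" "\<lambda>p. decay 1 (max_deg p n)"] decay_pos
    by (auto simp: ce_const valid_code_def less_imp_le)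
  have hi: "ce n 0 (\<lambda>p. decay 1 (max_deg p n)) q \<le> exp (- ?s n)" for n
  proof -
    have "ce n 0 (\<lambda>p. decay 1 (max_deg p n)) q \<le> decay 1 (max_deg q 0) * exp (- ?s n)"
      using decay_1_expect[of n 0 q] by (simp add: lessThan_atLeast0)
    also have "\<dots> \<le> 1 * exp (- ?s n)" by (intro mult_right_mono decay_le_1) auto
    finally show ?thesis by simp
  qed
  show ?thesis
  proof (rule tendsto_sandwich)
    show "\<forall>\<^sub>F n in sequentially. 0 \<le> ce n 0 (\<lambda>p. decay 1 (max_deg p n)) q"
      using lo by (intro always_eventually allI)
    show "\<forall>\<^sub>F n in sequentially. ce n 0 (\<lambda>p. decay 1 (max_deg p n)) q \<le> exp (- ?s n)"
      using hi by (intro always_eventually allI)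
  qed (fact tendsto_const lim)+
qed

end

section \<open>Exponential clocks\<close>

text \<open>The expectation of \<open>g (x + \<sigma> * T)\<close> for an exponential
  \<open>T\<close> of rate \<open>s\<close>. Values in \<open>ennreal\<close> allow Fubini without
  integrability conditions.\<close>

definition exp_shift :: "real \<Rightarrow> real \<Rightarrow> (real \<Rightarrow> ennreal) \<Rightarrow> real \<Rightarrow> ennreal" where
  "exp_shift s \<sigma> g x = (\<integral>\<^sup>+t. ennreal (exponential_density s t) * g (x + \<sigma> * t) \<partial>lborel)"

lemma exp_shift_measurable [measurable]:
  assumes [measurable]: "g \<in> borel_measurable borel"
  shows "exp_shift s \<sigma> g \<in> borel_measurable borel"
  unfolding exp_shift_def by measurable

lemma exp_shift_mono: "(\<And>x. g x \<le> h x) \<Longrightarrow> exp_shift s \<sigma> g x \<le> exp_shift s \<sigma> h x"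
  unfolding exp_shift_def by (intro nn_integral_mono mult_left_mono) auto

lemma exp_shift_add:
  assumes [measurable]: "g \<in> borel_measurable borel" "h \<in> borel_measurable borel"
  shows "exp_shift s \<sigma> (\<lambda>x. g x + h x) x = exp_shift s \<sigma> g x + exp_shift s \<sigma> h x"
  unfolding exp_shift_def by (simp add: distrib_left nn_integral_add)

lemma nn_integral_exponential_density:
  "s > 0 \<Longrightarrow> (\<integral>\<^sup>+t. ennreal (exponential_density s t) \<partial>lborel) = 1"
  using nn_integral_erlang_ith_moment[of s 0 0] by simp

lemma exp_shift_const: "s > 0 \<Longrightarrow> exp_shift s \<sigma> (\<lambda>_. c) x = c"
  unfolding exp_shift_def by (simp add: nn_integral_multc nn_integral_exponential_density)

lemma nn_integral_translate:
  fixes c :: real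
  assumes [measurable]: "g \<in> borel_measurable borel"
  shows "(\<integral>\<^sup>+x. g (x + c) \<partial>lborel) = (\<integral>\<^sup>+x. g x \<partial>lborel)"
  by (subst (2) nn_integral_real_affine[where c = 1 and t = c]) (auto simp: add.commute)

text \<open>Fubini and translation invariance of Lebesgue measure.\<close>

lemma nn_integral_exp_shift:
  assumes [measurable]: "g \<in> borel_measurable borel" and "s > 0"
  shows "(\<integral>\<^sup>+x. exp_shift s \<sigma> g x \<partial>lborel) = (\<integral>\<^sup>+x. g x \<partial>lborel)"
proof -
  have "(\<integral>\<^sup>+x. exp_shift s \<sigma> g x \<partial>lborel) =
      (\<integral>\<^sup>+t. \<integral>\<^sup>+x. ennreal (exponential_density s t) * g (x + \<sigma> * t) \<partial>lborel \<partial>lborel)"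
    unfolding exp_shift_def by (intro lborel_pair.Fubini') simp
  also have "\<dots> = (\<integral>\<^sup>+t. ennreal (exponential_density s t) * (\<integral>\<^sup>+x. g x \<partial>lborel) \<partial>lborel)"
    by (intro nn_integral_cong) (simp add: nn_integral_cmult nn_integral_translate)
  also have "\<dots> = (\<integral>\<^sup>+x. g x \<partial>lborel)"
    using assms by (simp add: nn_integral_multc nn_integral_exponential_density)
  finally show ?thesis .
qed

text \<open>The exponential density is bounded by its rate \<open>s\<close>.\<close>

lemma exp_shift_le_integral:
  assumes [measurable]: "g \<in> borel_measurable borel" and "s > 0"
  shows "exp_shift s 1 g x \<le> ennreal s * (\<integral>\<^sup>+x. g x \<partial>lborel)"
proof -
  have "exp_shift s 1 g x \<le> (\<integral>\<^sup>+t. ennreal s * g (t + x) \<partial>lborel)"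
    unfolding exp_shift_def using assms(2)
    by (intro nn_integral_mono mult_mono)
       (auto simp: exponential_density_def add.commute mult_le_cancel_left1 intro!: ennreal_leI)
  also have "\<dots> = ennreal s * (\<integral>\<^sup>+x. g x \<partial>lborel)"
    by (simp add: nn_integral_cmult nn_integral_translate)
  finally show ?thesis .
qed

lemma exp_shift_commute:
  assumes [measurable]: "g \<in> borel_measurable borel"
  shows "exp_shift s \<sigma> (exp_shift r \<tau> g) = exp_shift r \<tau> (exp_shift s \<sigma> g)"
proof
  fix x
  have "exp_shift s \<sigma> (exp_shift r \<tau> g) x =
      (\<integral>\<^sup>+t. \<integral>\<^sup>+t'. ennreal (exponential_density s t) *
        (ennreal (exponential_density r t') * g (x + \<sigma> * t + \<tau> * t')) \<partial>lborel \<partial>lborel)"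
    unfolding exp_shift_def by (simp add: nn_integral_cmult)
  also have "\<dots> = (\<integral>\<^sup>+t'. \<integral>\<^sup>+t. ennreal (exponential_density s t) *
        (ennreal (exponential_density r t') * g (x + \<sigma> * t + \<tau> * t')) \<partial>lborel \<partial>lborel)"
    by (intro lborel_pair.Fubini') simp
  also have "\<dots> = exp_shift r \<tau> (exp_shift s \<sigma> g) x"
    unfolding exp_shift_def
    by (simp add: nn_integral_cmult[symmetric] mult_ac add_ac)
  finally show "exp_shift s \<sigma> (exp_shift r \<tau> g) x = exp_shift r \<tau> (exp_shift s \<sigma> g) x" .
qed

text \<open>The density of a difference of independent exponentials is a two-sided exponential. At
  \<open>y = 0\<close> both terms on the right are positive, so that point is excluded.\<close>

lemma exponential_density_difference:
  assumes "s > 0" "r > 0" "y \<noteq> 0"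
  shows "(\<integral>\<^sup>+t. ennreal (exponential_density s t) * ennreal (exponential_density r (t - y)) \<partial>lborel)
    = ennreal (r / (s + r)) * ennreal (exponential_density s y)
      + ennreal (s / (s + r)) * ennreal (exponential_density r (- y))"
proof -
  \<comment> \<open>The two densities are both nonzero exactly for \<open>t \<ge> 0\<close> and
    \<open>t \<ge> y\<close>.\<close>
  let ?c = "max 0 y"
  let ?F = "\<lambda>t. - (s * r / (s + r) * exp (r * y - (s + r) * t))"
  have "(\<integral>\<^sup>+t. ennreal (exponential_density s t) * ennreal (exponential_density r (t - y)) \<partial>lborel)
      = (\<integral>\<^sup>+t. ennreal (s * r * exp (r * y - (s + r) * t)) * indicator {?c..} t \<partial>lborel)"
    using assms
    by (intro nn_integral_cong)
       (auto simp: exponential_density_def indicator_def ennreal_mult[symmetric] exp_add[symmetric]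
         algebra_simps)
  also have "\<dots> = ennreal (0 - ?F ?c)"
  proof (rule nn_integral_FTC_atLeast)
    have sr: "s + r > 0" "s + r \<noteq> 0" using assms by auto
    show "(?F has_real_derivative s * r * exp (r * y - (s + r) * t)) (at t)" for t
    proof -
      have "(?F has_real_derivative - (s * r / (s + r) * (exp (r * y - (s + r) * t) * (- (s + r))))) (at t)"
        using sr by (auto intro!: derivative_eq_intros)
      moreover have "- (s * r / N * (z * (- N))) = s * r * z" if "N \<noteq> 0" for N z :: real
        using that by simp
      ultimately show ?thesis using sr(2) by (simp only: not_False_eq_True)
    qed
    have "filterlim (\<lambda>t. r * y - (s + r) * t) at_bot at_top"
      unfolding filterlim_at_bot eventually_at_top_linorder
    proof (intro allI exI impI)
      fix Z t assume "(r * y - Z) / (s + r) \<le> t"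
      then show "r * y - (s + r) * t \<le> Z" using sr by (simp add: field_simps)
    qed
    then have "((\<lambda>t. exp (r * y - (s + r) * t)) \<longlongrightarrow> 0) at_top"
      by (rule filterlim_compose[OF exp_at_bot])
    from tendsto_minus[OF tendsto_mult_right_zero[OF this, of "s * r / (s + r)"]] show "(?F \<longlongrightarrow> 0) at_top"
      by simp
  qed (use assms in auto)
  also have "0 - ?F ?c = r / (s + r) * exponential_density s y
      + s / (s + r) * exponential_density r (- y)"
    using assms by (auto simp: exponential_density_def max_def algebra_simps)
  finally show ?thesis
    using assms by (simp add: ennreal_mult[symmetric] ennreal_plus[symmetric] del: ennreal_plus)
qed

text \<open>Memorylessness: the clock of rate \<open>s\<close> rings first with probability \<open>s / (s + r)\<close>,
  and the other one then starts afresh.\<close>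

lemma exp_shift_race:
  assumes [measurable]: "g \<in> borel_measurable borel" and sr: "s > 0" "r > 0"
  shows "exp_shift s 1 (exp_shift r (- 1) g) x =
    ennreal (r / (s + r)) * exp_shift s 1 g x + ennreal (s / (s + r)) * exp_shift r (- 1) g x"
proof -
  \<comment> \<open>Substitution of the difference \<open>y = t - t'\<close> for the second waiting
    time \<open>t'\<close>.\<close>
  have inner: "exp_shift r (- 1) g z = (\<integral>\<^sup>+y. ennreal (exponential_density r (t - y)) * g (z - t + y) \<partial>lborel)"
    for z t
    unfolding exp_shift_def
    by (subst nn_integral_real_affine[where c = "- 1" and t = t]) (auto simp: algebra_simps)
  have "exp_shift s 1 (exp_shift r (- 1) g) x =
      (\<integral>\<^sup>+t. ennreal (exponential_density s t) *
        (\<integral>\<^sup>+y. ennreal (exponential_density r (t - y)) * g (x + y) \<partial>lborel) \<partial>lborel)"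
    unfolding exp_shift_def[of s]
  proof (intro nn_integral_cong arg_cong2[where f = "(*)"] refl)
    fix t
    show "exp_shift r (- 1) g (x + 1 * t) = (\<integral>\<^sup>+y. ennreal (exponential_density r (t - y)) * g (x + y) \<partial>lborel)"
      by (subst inner[where t = t]) simp
  qed
  also have "\<dots> = (\<integral>\<^sup>+t. \<integral>\<^sup>+y. ennreal (exponential_density s t) *
        (ennreal (exponential_density r (t - y)) * g (x + y)) \<partial>lborel \<partial>lborel)"
    by (simp add: nn_integral_cmult)
  also have "\<dots> = (\<integral>\<^sup>+y. \<integral>\<^sup>+t. ennreal (exponential_density s t) *
        (ennreal (exponential_density r (t - y)) * g (x + y)) \<partial>lborel \<partial>lborel)"
    by (intro lborel_pair.Fubini') simp
  also have "\<dots> = (\<integral>\<^sup>+y. (\<integral>\<^sup>+t. ennreal (exponential_density s t) *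
        ennreal (exponential_density r (t - y)) \<partial>lborel) * g (x + y) \<partial>lborel)"
    by (simp add: nn_integral_multc mult.assoc[symmetric])
  also have "\<dots> = (\<integral>\<^sup>+y. (ennreal (r / (s + r)) * ennreal (exponential_density s y)
      + ennreal (s / (s + r)) * ennreal (exponential_density r (- y))) * g (x + y) \<partial>lborel)"
  proof (rule nn_integral_cong_AE)
    have "AE y in lborel. y \<noteq> (0::real)" by (rule AE_lborel_singleton)
    then show "AE y in lborel. (\<integral>\<^sup>+t. ennreal (exponential_density s t) *
        ennreal (exponential_density r (t - y)) \<partial>lborel) * g (x + y) =
      (ennreal (r / (s + r)) * ennreal (exponential_density s y)
        + ennreal (s / (s + r)) * ennreal (exponential_density r (- y))) * g (x + y)"
      by eventually_elim (simp add: exponential_density_difference sr)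
  qed
  also have "\<dots> = ennreal (r / (s + r)) * (\<integral>\<^sup>+y. ennreal (exponential_density s y) * g (x + y) \<partial>lborel)
      + ennreal (s / (s + r)) * (\<integral>\<^sup>+y. ennreal (exponential_density r (- y)) * g (x + y) \<partial>lborel)"
    by (simp add: distrib_right nn_integral_add nn_integral_cmult mult.assoc)
  also have "(\<integral>\<^sup>+y. ennreal (exponential_density r (- y)) * g (x + y) \<partial>lborel) = exp_shift r (- 1) g x"
    by (subst inner[where t = 0]) simp
  finally show ?thesis by (simp add: exp_shift_def)
qed

text \<open>The clock shifts the mean by \<open>\<sigma> / s\<close> and adds the variance
  \<open>1 / s^2\<close>. The offsets \<open>c\<close> and \<open>v\<close> carry the mean and
  variance of earlier clocks through the iteration.\<close>

lemma exp_shift_square: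
  assumes "s > 0" "\<sigma>\<^sup>2 = 1" "v \<ge> 0"
  shows "exp_shift s \<sigma> (\<lambda>x. ennreal ((x + c)\<^sup>2 + v)) x = ennreal ((x + c + \<sigma> / s)\<^sup>2 + v + 1 / s\<^sup>2)"
proof -
  have moment: "has_bochner_integral lborel (\<lambda>t. exponential_density s t * t ^ i) (fact i / s ^ i)" for i
  proof (rule has_bochner_integral_nn_integral)
    show "AE t in lborel. 0 \<le> exponential_density s t * t ^ i"
      using assms by (auto simp: exponential_density_def)
    show "(\<integral>\<^sup>+t. ennreal (exponential_density s t * t ^ i) \<partial>lborel) = ennreal (fact i / s ^ i)"
      using nn_integral_erlang_ith_moment[of s 0 i] assms by simp
  qed (use assms in auto)
  let ?A = "(x + c)\<^sup>2 + v" and ?B = "2 * \<sigma> * (x + c)"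
  have "has_bochner_integral lborel
      (\<lambda>t. ?A * (exponential_density s t * t ^ 0) + ?B * (exponential_density s t * t ^ 1)
        + exponential_density s t * t ^ 2)
      (?A * (fact 0 / s ^ 0) + ?B * (fact 1 / s ^ 1) + fact 2 / s ^ 2)"
    by (intro has_bochner_integral_add has_bochner_integral_mult_right moment)
  moreover have "?A * (exponential_density s t * t ^ 0) + ?B * (exponential_density s t * t ^ 1)
      + exponential_density s t * t ^ 2 = exponential_density s t * ((x + \<sigma> * t + c)\<^sup>2 + v)" for t
  proof -
    have "(x + \<sigma> * t + c)\<^sup>2 = (x + c)\<^sup>2 + 2 * \<sigma> * (x + c) * t + \<sigma>\<^sup>2 * t\<^sup>2"
      by (simp add: power2_eq_square algebra_simps)
    then show ?thesis using assms by (simp add: algebra_simps)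
  qed
  moreover have "?A * (fact 0 / s ^ 0) + ?B * (fact 1 / s ^ 1) + fact 2 / s ^ 2
      = (x + c + \<sigma> / s)\<^sup>2 + v + 1 / s\<^sup>2"
  proof -
    have "(x + c + \<sigma> / s)\<^sup>2 = (x + c)\<^sup>2 + 2 * \<sigma> * (x + c) / s + \<sigma>\<^sup>2 / s\<^sup>2"
      by (simp add: power2_eq_square algebra_simps add_divide_distrib)
    then show ?thesis using assms by (simp add: fact_numeral)
  qed
  ultimately have "has_bochner_integral lborel (\<lambda>t. exponential_density s t * ((x + \<sigma> * t + c)\<^sup>2 + v))
      ((x + c + \<sigma> / s)\<^sup>2 + v + 1 / s\<^sup>2)" by (simp only:)
  then have "(\<integral>\<^sup>+t. ennreal (exponential_density s t * ((x + \<sigma> * t + c)\<^sup>2 + v)) \<partial>lborel)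
      = ennreal ((x + c + \<sigma> / s)\<^sup>2 + v + 1 / s\<^sup>2)"
    using assms by (subst nn_integral_eq_integral)
      (auto simp: has_bochner_integral_iff exponential_density_def)
  then show ?thesis
    using assms by (simp add: exp_shift_def ennreal_mult)
qed

text \<open>Independent clocks of rates \<open>f a\<close> to \<open>f (a + n - 1)\<close>: a finite
  section of the total waiting time of a vertex of degree \<open>a\<close>.\<close>

primrec exp_shifts ::
  "(nat \<Rightarrow> real) \<Rightarrow> real \<Rightarrow> nat \<Rightarrow> nat \<Rightarrow> (real \<Rightarrow> ennreal) \<Rightarrow> real \<Rightarrow> ennreal" where
  "exp_shifts f \<sigma> 0 a g = g"
| "exp_shifts f \<sigma> (Suc n) a g = exp_shift (f a) \<sigma> (exp_shifts f \<sigma> n (Suc a) g)"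

lemma exp_shifts_measurable [measurable]:
  assumes [measurable]: "g \<in> borel_measurable borel"
  shows "exp_shifts f \<sigma> n a g \<in> borel_measurable borel"
  by (induction n arbitrary: a) auto

lemma exp_shifts_mono: "(\<And>x. g x \<le> h x) \<Longrightarrow> exp_shifts f \<sigma> n a g x \<le> exp_shifts f \<sigma> n a h x"
  by (induction n arbitrary: a x) (auto intro: exp_shift_mono)

lemma exp_shifts_add:
  assumes [measurable]: "g \<in> borel_measurable borel" "h \<in> borel_measurable borel"
  shows "exp_shifts f \<sigma> n a (\<lambda>x. g x + h x) = (\<lambda>x. exp_shifts f \<sigma> n a g x + exp_shifts f \<sigma> n a h x)"
  by (induction n arbitrary: a) (auto simp: exp_shift_add)

lemma exp_shifts_commute:
  assumes [measurable]: "g \<in> borel_measurable borel"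
  shows "exp_shifts f \<sigma> n a (exp_shift r \<tau> g) = exp_shift r \<tau> (exp_shifts f \<sigma> n a g)"
  by (induction n arbitrary: a) (auto simp: exp_shift_commute)

section \<open>Sums of clocks and ties of high degree\<close>

context attachment
begin

lemma exp_shifts_const: "exp_shifts f \<sigma> n a (\<lambda>_. c) = (\<lambda>_. c)"
  by (induction n arbitrary: a) (auto simp: exp_shift_const f_pos)

lemma nn_integral_exp_shifts:
  assumes [measurable]: "g \<in> borel_measurable borel"
  shows "(\<integral>\<^sup>+x. exp_shifts f \<sigma> n a g x \<partial>lborel) = (\<integral>\<^sup>+x. g x \<partial>lborel)"
  by (induction n arbitrary: a) (auto simp: nn_integral_exp_shift f_pos)

lemma exp_shifts_square:
  assumes "\<sigma>\<^sup>2 = 1" "v \<ge> 0"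
  shows "exp_shifts f \<sigma> n a (\<lambda>x. ennreal ((x + c)\<^sup>2 + v)) =
    (\<lambda>x. ennreal ((x + (c + (\<Sum>i=a..<a + n. \<sigma> / f i)))\<^sup>2 + (v + (\<Sum>i=a..<a + n. 1 / (f i)\<^sup>2))))"
proof (induction n arbitrary: a)
  case (Suc n)
  have split: "(\<Sum>i=a..<a + Suc n. h i) = h a + (\<Sum>i=Suc a..<Suc a + n. h i)" for h :: "nat \<Rightarrow> real"
    by (subst sum.atLeast_Suc_lessThan) auto
  show ?case
    using assms f_pos unfolding split exp_shifts.simps Suc.IH
    by (subst exp_shift_square) (auto simp: algebra_simps intro!: add_nonneg_nonneg sum_nonneg ext)
qed simp

lemma late_tie_bound:
  assumes e: "\<epsilon> > 0" and tail: "\<And>x D. d \<le> x \<Longrightarrow> (\<Sum>i=x..<D. 1 / (f i)\<^sup>2) \<le> \<epsilon>\<^sup>2 / 4"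
    and uv: "u \<noteq> v" "u \<le> k" "v \<le> k" "valid_code k q"
  shows "ce i k (\<lambda>p. of_bool (\<exists>t\<in>{k..k + i}. outdeg p t u = outdeg p t v \<and> d \<le> outdeg p t u)) q
    \<le> 4 * \<epsilon> * f (outdeg q k u)"
proof -
  \<comment> \<open>Degrees up to time \<open>k + i\<close> stay below \<open>D\<close>, so finitely
    many clocks suffice.\<close>
  define D where "D = Suc (k + i)"
  \<comment> \<open>The weight \<open>\<epsilon>^2\<close> prepares Chebyshev's inequality in the
    form \<open>\<epsilon>^2 \<le> g y + y^2\<close>.\<close>
  define g where "g x = ennreal (\<epsilon>\<^sup>2) * indicator {- \<epsilon>..\<epsilon>} x" for x :: real
  define E where "E a b = exp_shifts f 1 (D - a) a (exp_shifts f (- 1) (D - b) b g) 0" for a b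
  \<comment> \<open>The value 0 outside the square only lowers the left side of the superharmonic
    inequality inside it. The factor is chosen so that \<open>E x x \<ge> \<epsilon>^2 / 2\<close>
    gives \<open>H x x \<ge> 1\<close>.\<close>
  define H where "H a b = (if a < D \<and> b < D then 2 / \<epsilon>\<^sup>2 * enn2real (E a b) else 0)" for a b
  have g [measurable]: "g \<in> borel_measurable borel" unfolding g_def by measurable
  have "E a b \<le> exp_shifts f 1 (D - a) a (exp_shifts f (- 1) (D - b) b (\<lambda>_. ennreal (\<epsilon>\<^sup>2))) 0" for a b
    unfolding E_def by (intro exp_shifts_mono) (auto simp: g_def indicator_def)
  then have fin: "E a b < top" for a b
    by (simp add: exp_shifts_const) (metis ennreal_less_top le_less_trans)
  have E_step: "(f a + f b) * enn2real (E a b) = f a * enn2real (E (Suc a) b) + f b * enn2real (E a (Suc b))"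
    if ab: "a < D" "b < D" for a b
  proof -
    \<comment> \<open>The first clock of each vertex is split off, and memorylessness applies to
      this pair.\<close>
    have "D - a = Suc (D - Suc a)" "D - b = Suc (D - Suc b)" using ab by auto
    then have "E a b = ennreal (f b / (f a + f b)) * E a (Suc b) + ennreal (f a / (f a + f b)) * E (Suc a) b"
      unfolding E_def by (simp add: exp_shifts_commute exp_shift_race f_pos)
    then have "enn2real (E a b) = f b / (f a + f b) * enn2real (E a (Suc b))
        + f a / (f a + f b) * enn2real (E (Suc a) b)"
      using fin f_pos[of a] f_pos[of b]
      by (simp add: enn2real_plus enn2real_mult ennreal_mult_less_top)
    then have "enn2real (E a b) = (f a * enn2real (E (Suc a) b) + f b * enn2real (E a (Suc b))) / (f a + f b)"
      by (simp add: add_divide_distrib)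
    moreover have "f a + f b > 0" using f_pos[of a] f_pos[of b] by simp
    ultimately show ?thesis by (simp add: nonzero_eq_divide_eq mult.commute)
  qed
  have H_nonneg: "0 \<le> H a b" for a b by (simp add: H_def)
  have "race_superharmonic f 0 H"
    unfolding race_superharmonic_def
  proof (intro allI impI conjI H_nonneg)
    fix a b
    show "f a * H (Suc a) b + f b * H a (Suc b) \<le> (f a + f b) * H a b"
    proof (cases "a < D \<and> b < D")
      case True
      have le: "H a' b' \<le> 2 / \<epsilon>\<^sup>2 * enn2real (E a' b')" for a' b' by (simp add: H_def)
      have "f a * H (Suc a) b + f b * H a (Suc b)
          \<le> f a * (2 / \<epsilon>\<^sup>2 * enn2real (E (Suc a) b)) + f b * (2 / \<epsilon>\<^sup>2 * enn2real (E a (Suc b)))"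
        using f_pos[of a] f_pos[of b] by (intro add_mono mult_left_mono le) auto
      also have "\<dots> = 2 / \<epsilon>\<^sup>2 * ((f a + f b) * enn2real (E a b))"
        using True by (subst E_step) (auto simp: algebra_simps)
      also have "\<dots> = (f a + f b) * H a b" using True by (simp add: H_def)
      finally show ?thesis .
    qed (auto simp: H_def)
  qed
  moreover have "1 \<le> H x x" if x: "x \<le> k + i" "d \<le> x" for x
  proof -
    have xD: "x < D" using x by (simp add: D_def)
    let ?T = "\<lambda>h. exp_shifts f 1 (D - x) x (exp_shifts f (- 1) (D - x) x h) 0"
    \<comment> \<open>The zeros match the form of \<open>exp_shifts_square\<close>.\<close>
    have sq: "(\<lambda>y::real. ennreal ((y + 0)\<^sup>2 + 0)) \<in> borel_measurable borel" by measurable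
    have "\<epsilon>\<^sup>2 \<le> y\<^sup>2" if "\<not> (- \<epsilon> \<le> y \<and> y \<le> \<epsilon>)" for y
      using that e by (intro abs_le_square_iff[THEN iffD1]) auto
    then have "ennreal (\<epsilon>\<^sup>2) \<le> g y + ennreal ((y + 0)\<^sup>2 + 0)" for y
      by (auto simp: g_def indicator_def intro!: ennreal_leI)
    then have "?T (\<lambda>_. ennreal (\<epsilon>\<^sup>2)) \<le> ?T (\<lambda>y. g y + ennreal ((y + 0)\<^sup>2 + 0))"
      by (intro exp_shifts_mono)
    also have "\<dots> = E x x + ?T (\<lambda>y. ennreal ((y + 0)\<^sup>2 + 0))"
      unfolding exp_shifts_add[OF g sq]
        exp_shifts_add[OF exp_shifts_measurable[OF g] exp_shifts_measurable[OF sq]] E_def ..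
    \<comment> \<open>At equal degrees the two means cancel, and only twice the sum of the variances
      remains.\<close>
    also have "?T (\<lambda>y. ennreal ((y + 0)\<^sup>2 + 0)) = ennreal (2 * (\<Sum>i=x..<D. 1 / (f i)\<^sup>2))"
      using xD by (subst exp_shifts_square, simp, simp, subst exp_shifts_square)
        (auto simp: sum_nonneg sum_negf)
    also have "\<dots> \<le> ennreal (\<epsilon>\<^sup>2 / 2)" using tail[of x D] x by (intro ennreal_leI) simp
    finally have "ennreal (\<epsilon>\<^sup>2) \<le> E x x + ennreal (\<epsilon>\<^sup>2 / 2)"
      by (simp add: exp_shifts_const add_left_mono)
    also have "E x x = ennreal (enn2real (E x x))" using fin by simp
    finally have "\<epsilon>\<^sup>2 \<le> enn2real (E x x) + \<epsilon>\<^sup>2 / 2"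
      by (simp add: ennreal_plus[symmetric] del: ennreal_plus)
    then show ?thesis using e xD by (simp add: H_def field_simps)
  qed
  ultimately have "ce i k (\<lambda>p. of_bool (\<exists>t\<in>{k..k + i}. outdeg p t u = outdeg p t v \<and> d \<le> outdeg p t u)) q
    \<le> H (outdeg q k u) (outdeg q k v)"
    using uv by (intro tie_bound) auto
  also have "\<dots> \<le> 4 * \<epsilon> * f (outdeg q k u)"
  proof -
    let ?a = "outdeg q k u" and ?b = "outdeg q k v"
    have lt: "?a < D" "?b < D" using outdeg_le[of q k u] outdeg_le[of q k v] by (auto simp: D_def)
    \<comment> \<open>Only the first clock of \<open>u\<close> is used for its bounded density; all
      others preserve the integral of \<open>g\<close>, which is \<open>\<epsilon>^2\<close> times
      the interval length \<open>2 * \<epsilon>\<close>.\<close>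
    then have "D - ?a = Suc (D - Suc ?a)" by simp
    then have "E ?a ?b \<le> ennreal (f ?a) *
        (\<integral>\<^sup>+x. exp_shifts f 1 (D - Suc ?a) (Suc ?a) (exp_shifts f (- 1) (D - ?b) ?b g) x \<partial>lborel)"
      unfolding E_def by (simp add: exp_shift_le_integral f_pos)
    also have "\<dots> = ennreal (f ?a) * (\<integral>\<^sup>+x. g x \<partial>lborel)"
      by (simp add: nn_integral_exp_shifts)
    also have "(\<integral>\<^sup>+x. g x \<partial>lborel) = ennreal (2 * \<epsilon> ^ 3)"
      unfolding g_def using e
      by (subst nn_integral_cmult_indicator) (auto simp: ennreal_mult[symmetric] power2_eq_square power3_eq_cube)
    finally have "enn2real (E ?a ?b) \<le> f ?a * (2 * \<epsilon> ^ 3)"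
      using e f_pos[of ?a] by (intro enn2real_leI) (auto simp: ennreal_mult)
    then have "2 / \<epsilon>\<^sup>2 * enn2real (E ?a ?b) \<le> 2 / \<epsilon>\<^sup>2 * (f ?a * (2 * \<epsilon> ^ 3))"
      by (intro mult_left_mono) auto
    also have "\<dots> = 4 * \<epsilon> * f ?a" using e by (simp add: power2_eq_square power3_eq_cube)
    finally show ?thesis using lt by (simp add: H_def)
  qed
  finally show ?thesis .
qed

end

section \<open>The hub\<close>

text \<open>At most one of the two degrees grows in a step, and by 1, so the order cannot reverse
  without a tie.\<close>

lemma outdeg_less_persists:
  assumes "\<And>t. k \<le> t \<Longrightarrow> outdeg p t u \<noteq> outdeg p t v" "outdeg p k v < outdeg p k u" "k \<le> t"
  shows "outdeg p t v < outdeg p t u"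
  using assms(3)
proof (induction t rule: dec_induct)
  case (step t)
  have "outdeg p (Suc t) u \<noteq> outdeg p (Suc t) v" using step by (intro assms) simp
  with step show ?case by (auto simp: outdeg_Suc split: if_splits)
qed (fact assms(2))

text \<open>The pathwise part of the argument: from the almost sure properties to the hub, without
  probability.\<close>

lemma ex_unique_persistent_hub:
  assumes valid: "\<And>n. valid_code n p"
    and unbounded: "\<And>m. \<exists>n. m \<le> max_deg p n"
    and newcomers: "\<forall>\<^sub>F k in sequentially. \<forall>t\<ge>k. outdeg p t (leader p k) \<noteq> outdeg p t k"
    and ties: "\<And>u v. u \<noteq> v \<Longrightarrow> \<exists>d. \<forall>t\<ge>max u v. outdeg p t u = outdeg p t v \<longrightarrow> outdeg p t u < d"
  shows "\<exists>u. unique_persistent_hub p u"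
proof -
  obtain K where K: "\<And>k t. K \<le> k \<Longrightarrow> k \<le> t \<Longrightarrow> outdeg p t (leader p k) \<noteq> outdeg p t k" "1 \<le> K"
    using newcomers unfolding eventually_sequentially by (metis max.bounded_iff nle_le)
  \<comment> \<open>A vertex born from time \<open>K\<close> on stays strictly below the vertex that
    led at its birth, so it never attains the maximum.\<close>
  have early: "v < K" if v: "v \<le> t" "outdeg p t v = max_deg p t" for v t
  proof (rule ccontr)
    assume "\<not> v < K"
    then have vK: "K \<le> v" "1 \<le> v" using K(2) by auto
    have "outdeg p v v < outdeg p v (leader p v)"
      using outdeg_newborn[OF valid] max_deg_pos[OF valid vK(2)] leader_props(2)[of p v] by simp
    then have "outdeg p t v < outdeg p t (leader p v)"
      using outdeg_less_persists[OF K(1)[OF vK(1)]] v(1) by blast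
    moreover have "outdeg p t (leader p v) \<le> max_deg p t"
      using leader_props(1)[of p v] v by (intro max_deg_ge) simp
    ultimately show False using v by simp
  qed
  obtain d where d: "\<And>u v t. u \<noteq> v \<Longrightarrow> max u v \<le> t \<Longrightarrow> outdeg p t u = outdeg p t v \<Longrightarrow> outdeg p t u < d u v"
    using ties by metis
  \<comment> \<open>Only pairs below \<open>K\<close> can tie for the lead, so finitely many bounds
    \<open>d u v\<close> have to be exceeded.\<close>
  define m where "m = Max ((\<lambda>(u, v). d u v) ` ({..<K} \<times> {..<K}))"
  obtain T0 where T0: "m \<le> max_deg p T0" using unbounded by blast
  have m_ge: "d u v \<le> m" if "u < K" "v < K" for u v
    unfolding m_def using that by (intro Max_ge) force+
  have unique: "u = v" if "T0 \<le> t" "u \<le> t" "v \<le> t" "outdeg p t u = max_deg p t" "outdeg p t v = max_deg p t"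
    for u v t
  proof (rule ccontr)
    assume "u \<noteq> v"
    with that have "max_deg p t < d u v" using d[of u v t] by simp
    also have "d u v \<le> m" using that by (intro m_ge early)
    also have "m \<le> max_deg p t" using T0 max_deg_mono[OF that(1), of p] by simp
    finally show False by simp
  qed
  define h where "h = leader p T0"
  have h: "h \<le> t \<and> outdeg p t h = max_deg p t" if "T0 \<le> t" for t
    using that
  proof (induction t rule: dec_induct)
    case base
    then show ?case using leader_props[of p T0] by (simp add: h_def)
  next
    case (step t)
    let ?v = "leader p (Suc t)"
    have v: "?v \<le> Suc t" "outdeg p (Suc t) ?v = max_deg p (Suc t)" using leader_props[of p "Suc t"] by auto
    show ?case
    proof (cases "?v = h")
      case False
      \<comment> \<open>A strict deficit at time \<open>t\<close> can at most become a tie at time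
        \<open>Suc t\<close>, so \<open>h\<close> still attains the maximum.\<close>
      have "outdeg p t ?v < outdeg p t h"
      proof (cases "?v \<le> t")
        case True
        then have "outdeg p t ?v \<le> max_deg p t" by (rule max_deg_ge)
        moreover have "outdeg p t ?v \<noteq> max_deg p t" using unique[of t ?v h] step True False by auto
        ultimately show ?thesis using step by simp
      next
        case False
        then have "?v = Suc t" using v by simp
        then have "outdeg p (Suc t) ?v = 0" using outdeg_newborn[OF valid] by simp
        then have "max_deg p (Suc t) = 0" using v by simp
        then show ?thesis using max_deg_pos[OF valid, of "Suc t"] by simp
      qed
      then have "outdeg p (Suc t) ?v \<le> outdeg p (Suc t) h" by (simp add: outdeg_Suc)
      moreover have "outdeg p (Suc t) h \<le> max_deg p (Suc t)" using step by (intro max_deg_ge) simp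
      ultimately show ?thesis using v step by simp
    qed (use v in auto)
  qed
  have "persistent_hub p h"
    unfolding persistent_hub_def eventually_sequentially using h max_deg_ge[of _ _ p] by metis
  moreover have "v = h" if "persistent_hub p v" for v
  proof -
    obtain N where N: "\<And>n. N \<le> n \<Longrightarrow> v \<le> n \<and> (\<forall>w\<le>n. outdeg p n w \<le> outdeg p n v)"
      using \<open>persistent_hub p v\<close> unfolding persistent_hub_def eventually_sequentially by blast
    let ?n = "max N T0"
    have "v \<le> ?n" "\<forall>w\<le>?n. outdeg p ?n w \<le> outdeg p ?n v" using N[of ?n] by auto
    moreover have hn: "h \<le> ?n" "outdeg p ?n h = max_deg p ?n" using h[of ?n] by auto
    ultimately have "outdeg p ?n v = max_deg p ?n" using max_deg_ge[of v ?n p] by (metis order_antisym)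
    with \<open>v \<le> ?n\<close> hn show "v = h" using unique[of ?n v h] by simp
  qed
  ultimately show ?thesis unfolding unique_persistent_hub_def by blast
qed

context linear_attachment
begin

text \<open>Growth with \<open>i = 0\<close> makes \<open>f\<close> at least linear.\<close>

lemma summable_inverse_square_f: "summable (\<lambda>i. 1 / (f i)\<^sup>2)"
proof (rule summable_comparison_test'[where N = 0])
  have "summable (\<lambda>i. inverse (real (i + 1) ^ 2))"
    using inverse_power_summable[of 2, where 'a = real] summable_Suc_iff[of "\<lambda>i. inverse (real i ^ 2)"] by simp
  then show "summable (\<lambda>i. (\<kappa> / f 0)\<^sup>2 * inverse (real (i + 1) ^ 2))" by (rule summable_mult)
  fix i
  have "1 / f i \<le> \<kappa> / f 0 * inverse (real (i + 1))"
  proof -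
    have "f 0 * real (i + 1) \<le> \<kappa> * f i" using growth[of 0 i] by (simp add: field_simps)
    then show ?thesis using f_pos[of i] f_pos[of 0] by (simp add: divide_simps mult_ac)
  qed
  then have "(1 / f i)\<^sup>2 \<le> (\<kappa> / f 0 * inverse (real (i + 1)))\<^sup>2"
    using f_pos[of i] by (intro power_mono) auto
  then show "norm (1 / (f i)\<^sup>2) \<le> (\<kappa> / f 0)\<^sup>2 * inverse (real (i + 1) ^ 2)"
    by (simp add: power_mult_distrib power_divide power_inverse)
qed

lemma inverse_square_f_tail:
  assumes "\<delta> > 0"
  obtains d where "\<And>x D. d \<le> x \<Longrightarrow> (\<Sum>i=x..<D. 1 / (f i)\<^sup>2) \<le> \<delta>"
proof -
  obtain d where "\<And>m n. d \<le> m \<Longrightarrow> norm (\<Sum>i=m..<n. 1 / (f i)\<^sup>2) < \<delta>"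
    using summable_inverse_square_f assms unfolding summable_Cauchy by blast
  then show ?thesis by (intro that) (force simp: abs_less_iff intro: less_imp_le)
qed

text \<open>Two conditionings: from \<open>K\<close> to \<open>k\<close> the expected
  \<open>decay\<close> shrinks quadratically, and from \<open>k\<close> to \<open>n\<close> newcomer
  \<open>k\<close> races the leader. The condition on \<open>max_deg p K\<close> is settled at time
  \<open>K\<close> and makes both bounds applicable.\<close>

lemma newcomer_expect:
  assumes r: "real r \<ge> 8 * \<kappa>" and m0: "real m0 \<ge> 2 * real r ^ 2 * \<kappa> ^ 4" "r \<le> m0"
    and K: "2 \<le> K" "K \<le> k" "k \<le> n"
  shows "ce n 0 (\<lambda>p. of_bool (m0 \<le> max_deg p K \<and>
      (\<exists>t\<in>{k..n}. outdeg p t (leader p k) = outdeg p t k))) (\<lambda>_. 0)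
    \<le> 2 * (real K * real (K - 1)) / (real k * real (k - 1))"
proof -
  let ?P = "\<lambda>p. \<exists>t\<in>{k..n}. outdeg p t (leader p k) = outdeg p t k"
  let ?c = "real K * real (K - 1) / (real k * real (k - 1))"
  obtain i where i: "k = K + i" using K by (metis le_iff_add)
  obtain j where j: "n = k + j" using K by (metis le_iff_add)
  have m0_pos: "1 \<le> m0" using r m0 kappa_ge_1 by linarith
  have step2: "ce j k (\<lambda>p. of_bool (m0 \<le> max_deg p K \<and> ?P p)) q \<le> 2 * decay r (max_deg q k)"
    if q: "valid_code k q" "m0 \<le> max_deg q K" for q
  proof -
    let ?m = "max_deg q k"
    have m: "m0 \<le> ?m" using q max_deg_mono[of K k q] K by simp
    \<comment> \<open>Vertex \<open>k\<close> has degree 0 at its birth, while the leader has degree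
      at least \<open>m0\<close>.\<close>
    have ne: "leader q k \<noteq> k"
      using leader_props(2)[of q k] outdeg_newborn[OF q(1)] m m0_pos by auto
    have "ce j k (\<lambda>p. of_bool (m0 \<le> max_deg p K \<and> ?P p)) q
        \<le> ce j k (\<lambda>p. of_bool (\<exists>t\<in>{k..k + j}. outdeg p t (leader q k) = outdeg p t k)) q"
    proof (rule ce_mono)
      fix p assume "\<forall>l\<le>k. p l = q l"
      then have "leader p k = leader q k" by (intro leader_cong) auto
      then show "of_bool (m0 \<le> max_deg p K \<and> ?P p)
          \<le> (of_bool (\<exists>t\<in>{k..k + j}. outdeg p t (leader q k) = outdeg p t k) :: real)"
        by (auto simp: j)
    qed (use q in auto)
    also have "\<dots> \<le> 2 * decay r ?m"
      using q m m0 m0_pos ne leader_props[of q k] outdeg_newborn[OF q(1)]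
      by (intro newcomer_bound) (auto intro: order_trans)
    finally show ?thesis .
  qed
  have step1: "ce (i + j) K (\<lambda>p. of_bool (m0 \<le> max_deg p K \<and> ?P p)) q \<le> 2 * ?c"
    if q: "valid_code K q" for q
  proof (cases "m0 \<le> max_deg q K")
    case True
    have "ce (i + j) K (\<lambda>p. of_bool (m0 \<le> max_deg p K \<and> ?P p)) q
        \<le> ce i K (\<lambda>p. 2 * decay r (max_deg p k)) q"
      unfolding ce_tower i[symmetric]
    proof (rule ce_mono[OF q])
      fix p assume "valid_code (K + i) p" "\<forall>l\<le>K. p l = q l"
      then have "valid_code k p" "max_deg p K = max_deg q K" by (auto simp: i intro: max_deg_cong)
      with True show "ce j k (\<lambda>p. of_bool (m0 \<le> max_deg p K \<and> ?P p)) p \<le> 2 * decay r (max_deg p k)"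
        by (intro step2) auto
    qed
    also have "\<dots> = 2 * ce i K (\<lambda>p. decay r (max_deg p (K + i))) q" by (simp add: ce_cmult i)
    also have "\<dots> \<le> 2 * (decay r (max_deg q K) * ?c)"
      using decay_expect_quadratic[of K r q i] K r m0 True by (intro mult_left_mono) (auto simp: i)
    also have "\<dots> \<le> 2 * (1 * ?c)"
      by (intro mult_left_mono mult_right_mono decay_le_1) auto
    finally show ?thesis by simp
  next
    case False
    have "ce (i + j) K (\<lambda>p. of_bool (m0 \<le> max_deg p K \<and> ?P p)) q \<le> ce (i + j) K (\<lambda>_. 0) q"
    proof (rule ce_mono[OF q])
      fix p assume "\<forall>l\<le>K. p l = q l"
      then have "max_deg p K = max_deg q K" by (intro max_deg_cong) auto
      with False show "of_bool (m0 \<le> max_deg p K \<and> ?P p) \<le> (0::real)" by simp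
    qed
    also have "\<dots> = 0" by (rule ce_const)
    also have "0 \<le> 2 * ?c" by simp
    finally show ?thesis .
  qed
  have "ce (K + (i + j)) 0 (\<lambda>p. of_bool (m0 \<le> max_deg p K \<and> ?P p)) (\<lambda>_. 0)
      \<le> ce K 0 (\<lambda>_. 2 * ?c) (\<lambda>_. 0)"
    unfolding ce_tower[of K]
  proof (rule ce_mono)
    show "ce (i + j) (0 + K) (\<lambda>p. of_bool (m0 \<le> max_deg p K \<and> ?P p)) p \<le> 2 * ?c"
      if "valid_code (0 + K) p" for p
      using step1 that by simp
  qed (simp add: valid_code_def)
  then have "ce (K + (i + j)) 0 (\<lambda>p. of_bool (m0 \<le> max_deg p K \<and> ?P p)) (\<lambda>_. 0) \<le> 2 * ?c"
    unfolding ce_const .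
  moreover have "K + (i + j) = n" by (simp add: i j)
  ultimately show ?thesis by simp
qed

end

section \<open>Almost sure properties of the tree\<close>

locale linear_gpa = gpa f M X + linear_attachment f \<kappa>
  for f :: "nat \<Rightarrow> real" and M :: "'a measure" and X \<kappa>
begin

text \<open>Markov's inequality for \<open>decay 1\<close> of the maximal degree.\<close>

lemma AE_max_deg_unbounded: "AE \<omega> in M. \<forall>m. \<exists>n. m \<le> max_deg (X \<omega>) n"
  unfolding AE_all_countable
proof
  fix m
  let ?B = "\<lambda>n. {\<omega> \<in> space M. \<not> m \<le> max_deg (X \<omega>) n}"
  have det: "determined n (\<lambda>p. \<not> m \<le> max_deg p n)" for n
    by (rule determinedI) (metis max_deg_cong)
  have B [measurable]: "?B n \<in> sets M" for n using det by (rule determined_sets)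
  have le: "prob (?B n) \<le> real (m + 1) * ce n 0 (\<lambda>p. decay 1 (max_deg p n)) (\<lambda>_. 0)" for n
    unfolding prob_determined[OF det] ce_cmult[symmetric]
  proof (rule ce_mono)
    fix p :: "nat \<Rightarrow> nat"
    have "1 \<le> real (m + 1) * (1 / real (max_deg p n + 1))" if "max_deg p n < m"
      using that by (simp add: field_simps)
    then show "of_bool (\<not> m \<le> max_deg p n) \<le> real (m + 1) * decay 1 (max_deg p n)"
      unfolding decay_1 by (auto simp: of_bool_def)
  qed (simp add: valid_code_def)
  have lim: "(\<lambda>n. real (m + 1) * ce n 0 (\<lambda>p. decay 1 (max_deg p n)) (\<lambda>_. 0)) \<longlonglongrightarrow> real (m + 1) * 0"
    by (intro tendsto_intros decay_1_expect_tendsto)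
  let ?N = "\<Inter>n. ?B n"
  have "prob ?N \<le> prob (?B n)" for n by (intro finite_measure_mono) auto
  then have "prob ?N \<le> real (m + 1) * ce n 0 (\<lambda>p. decay 1 (max_deg p n)) (\<lambda>_. 0)" for n
    using le[of n] order_trans by blast
  then have "prob ?N \<le> real (m + 1) * 0"
    by (intro LIMSEQ_le_const[OF lim]) auto
  then have "prob ?N = 0" by (simp add: measure_le_0_iff)
  then have "AE \<omega> in M. \<omega> \<notin> ?N" by (intro AE_not_in) (auto simp: null_sets_def emeasure_eq_measure)
  then show "AE \<omega> in M. \<exists>n. m \<le> max_deg (X \<omega>) n"
    using AE_space by eventually_elim auto
qed

text \<open>Borel-Cantelli is applied for each fixed \<open>K\<close>; afterwards unboundedness of
  the maximal degree provides a random \<open>K\<close> with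
  \<open>m0 \<le> max_deg p K\<close>.\<close>

lemma AE_newcomers:
  "AE \<omega> in M. \<forall>\<^sub>F k in sequentially. \<forall>t\<ge>k. outdeg (X \<omega>) t (leader (X \<omega>) k) \<noteq> outdeg (X \<omega>) t k"
proof -
  define r where "r = nat \<lceil>8 * \<kappa>\<rceil>"
  define m0 where "m0 = max r (nat \<lceil>2 * real r ^ 2 * \<kappa> ^ 4\<rceil>)"
  have r: "real r \<ge> 8 * \<kappa>" unfolding r_def by linarith
  have m0: "real m0 \<ge> 2 * real r ^ 2 * \<kappa> ^ 4" "r \<le> m0"
    unfolding m0_def by (simp_all add: of_nat_max le_max_iff_disj real_nat_ceiling_ge)
  define P where "P K k n p \<longleftrightarrow> k \<le> n \<and> K \<le> k \<and> m0 \<le> max_deg p K \<and>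
      (\<exists>t\<in>{k..n}. outdeg p t (leader p k) = outdeg p t k)" for K k n p
  define A where "A K k = {\<omega> \<in> space M. \<exists>n. P K k n (X \<omega>)}" for K k
  have det: "determined n (P K k n)" for K k n
  proof (rule determinedI)
    fix p p' :: "nat \<Rightarrow> nat" assume eq: "\<And>i. i \<in> {1..n} \<Longrightarrow> p i = p' i"
    have "outdeg p t = outdeg p' t" if "t \<le> n" for t
      using that by (intro ext outdeg_cong eq) auto
    moreover have "max_deg p t = max_deg p' t" "leader p t = leader p' t" if "t \<le> n" for t
      using that by (auto intro!: max_deg_cong leader_cong eq)
    ultimately show "P K k n p = P K k n p'" unfolding P_def by (auto cong: conj_cong)
  qed
  have A_sets: "A K k \<in> sets M" for K k
  proof -
    have "A K k = (\<Union>n. {\<omega> \<in> space M. P K k n (X \<omega>)})" by (auto simp: A_def)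
    then show ?thesis using determined_sets[OF det] by auto
  qed
  have main: "AE \<omega> in M. \<forall>\<^sub>F k in sequentially. \<omega> \<in> space M - A K k" if K: "2 \<le> K" for K
  proof (rule borel_cantelli_AE1[OF A_sets])
    let ?b = "\<lambda>k. 2 * (real K * real (K - 1)) / (real k * real (k - 1))"
    have bound: "prob (A K k) \<le> ?b k" if "K \<le> k" for k
      unfolding A_def
    proof (rule prob_ex_le[where N = k])
      fix n assume "k \<le> n"
      then show "ce n 0 (\<lambda>p. of_bool (P K k n p)) (\<lambda>_. 0) \<le> ?b k"
        using newcomer_expect[OF r m0 K that] that by (simp add: P_def)
    next
      show "P K k n p \<Longrightarrow> P K k (Suc n) p" for n p by (auto simp: P_def)
    qed (fact det)
    show "summable (\<lambda>k. prob (A K k))"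
    proof (rule summable_comparison_test'[where N = K])
      have s: "summable (\<lambda>k. inverse (real k ^ 2))"
        using inverse_power_summable[of 2, where 'a = real] by simp
      show "summable (\<lambda>k. 4 * (real K * real (K - 1)) * inverse (real k ^ 2))"
        using s by (rule summable_mult)
      fix k assume k: "K \<le> k"
      \<comment> \<open>Since \<open>k \<ge> 2\<close>, the factor \<open>k - 1\<close> is at least
        \<open>k / 2\<close>.\<close>
      have "2 * (real k * real (k - 1)) \<ge> real k ^ 2"
        using k K by (simp add: of_nat_diff power2_eq_square algebra_simps)
      moreover have "1 / x \<le> 2 * inverse y" if "y \<le> 2 * x" "0 < x" "0 < y" for x y :: real
        using that by (simp add: field_simps)
      ultimately have "1 / (real k * real (k - 1)) \<le> 2 * inverse (real k ^ 2)"
        using k K by simp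
      then have "2 * (real K * real (K - 1)) * (1 / (real k * real (k - 1)))
          \<le> 2 * (real K * real (K - 1)) * (2 * inverse (real k ^ 2))"
        by (intro mult_left_mono) auto
      with bound[OF k] show "norm (prob (A K k)) \<le> 4 * (real K * real (K - 1)) * inverse (real k ^ 2)"
        by simp
    qed
  qed (simp add: emeasure_eq_measure)
  then have "AE \<omega> in M. \<forall>K. 2 \<le> K \<longrightarrow> (\<forall>\<^sub>F k in sequentially. \<omega> \<in> space M - A K k)"
    unfolding AE_all_countable by (auto intro: AE_impI)
  then show ?thesis using AE_max_deg_unbounded
  proof eventually_elim
    case (elim \<omega>)
    then obtain K0 where "m0 \<le> max_deg (X \<omega>) K0" by blast
    then have K: "m0 \<le> max_deg (X \<omega>) (max 2 K0)" (is "_ \<le> max_deg _ ?K")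
      using max_deg_mono[of K0 "max 2 K0" "X \<omega>"] by simp
    have "\<forall>\<^sub>F k in sequentially. \<omega> \<in> space M - A ?K k" using elim(1) by simp
    then show ?case using eventually_ge_at_top[of ?K]
    proof eventually_elim
      case (elim k)
      show ?case
      proof (intro allI impI notI)
        fix t assume "k \<le> t" "outdeg (X \<omega>) t (leader (X \<omega>) k) = outdeg (X \<omega>) t k"
        with elim K have "P ?K k t (X \<omega>)" by (auto simp: P_def)
        with elim show False by (auto simp: A_def)
      qed
    qed
  qed
qed

lemma AE_ties_bounded:
  assumes "u \<noteq> v"
  shows "AE \<omega> in M. \<exists>d. \<forall>t\<ge>max u v. outdeg (X \<omega>) t u = outdeg (X \<omega>) t v \<longrightarrow> outdeg (X \<omega>) t u < d"
proof -
  \<comment> \<open>The race starts once both vertices exist. At that time the degree of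
    \<open>u\<close> is at most \<open>k\<close>, so \<open>F\<close> bounds its weight whatever the
    tree.\<close>
  define k where "k = max u v"
  define F where "F = (\<Sum>i\<le>k. f i)"
  define P where "P d n p \<longleftrightarrow> (\<exists>t\<in>{k..n}. outdeg p t u = outdeg p t v \<and> d \<le> outdeg p t u)" for d n p
  define B where "B d = {\<omega> \<in> space M. \<exists>n. P d n (X \<omega>)}" for d
  have det: "determined n (P d n)" for d n
  proof (rule determinedI)
    fix p p' :: "nat \<Rightarrow> nat" assume eq: "\<And>i. i \<in> {1..n} \<Longrightarrow> p i = p' i"
    have "outdeg p t = outdeg p' t" if "t \<le> n" for t
      using that by (intro ext outdeg_cong eq) auto
    then show "P d n p = P d n p'" unfolding P_def by auto
  qed
  have B_sets: "B d \<in> sets M" for d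
  proof -
    have "B d = (\<Union>n. {\<omega> \<in> space M. P d n (X \<omega>)})" by (auto simp: B_def)
    then show ?thesis using determined_sets[OF det] by auto
  qed
  have F: "F > 0" unfolding F_def by (intro sum_pos f_pos) auto
  have small: "\<exists>d. prob (B d) \<le> 4 * \<epsilon> * F" if e: "\<epsilon> > 0" for \<epsilon>
  proof -
    obtain d where d: "\<And>x D. d \<le> x \<Longrightarrow> (\<Sum>i=x..<D. 1 / (f i)\<^sup>2) \<le> \<epsilon>\<^sup>2 / 4"
      using inverse_square_f_tail[of "\<epsilon>\<^sup>2 / 4"] e by auto
    have "prob (B d) \<le> 4 * \<epsilon> * F"
      unfolding B_def
    proof (rule prob_ex_le[where N = k])
      fix n assume "k \<le> n"
      then obtain i where n: "n = k + i" by (metis le_iff_add)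
      have "ce i k (\<lambda>p. of_bool (P d n p)) q \<le> 4 * \<epsilon> * F" if q: "valid_code k q" for q
      proof -
        have "ce i k (\<lambda>p. of_bool (P d n p)) q \<le> 4 * \<epsilon> * f (outdeg q k u)"
          unfolding P_def n using e d assms q by (intro late_tie_bound) (auto simp: k_def)
        also have "f (outdeg q k u) \<le> F"
          unfolding F_def using outdeg_le[of q k u] f_pos
          by (intro member_le_sum) (auto simp: less_imp_le)
        finally show ?thesis using e by simp
      qed
      then have "ce (k + i) 0 (\<lambda>p. of_bool (P d n p)) (\<lambda>_. 0) \<le> ce k 0 (\<lambda>_. 4 * \<epsilon> * F) (\<lambda>_. 0)"
        unfolding ce_tower by (intro ce_mono) (auto simp: valid_code_def)
      then show "ce n 0 (\<lambda>p. of_bool (P d n p)) (\<lambda>_. 0) \<le> 4 * \<epsilon> * F"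
        by (simp add: ce_const n)
    next
      show "P d n p \<Longrightarrow> P d (Suc n) p" for n p by (auto simp: P_def)
    qed (fact det)
    then show ?thesis by blast
  qed
  \<comment> \<open>Ties of arbitrarily high degree lie in every \<open>B d\<close>, and some
    \<open>B d\<close> has arbitrarily small probability.\<close>
  have "prob (\<Inter>d. B d) \<le> 0"
  proof (rule field_le_epsilon)
    fix e :: real assume e: "e > 0"
    obtain d where "prob (B d) \<le> 4 * (e / (4 * F)) * F"
      using small[of "e / (4 * F)"] e F by auto
    moreover have "prob (\<Inter>d. B d) \<le> prob (B d)"
      using B_sets by (intro finite_measure_mono) auto
    ultimately show "prob (\<Inter>d. B d) \<le> 0 + e" using F by simp
  qed
  then have "prob (\<Inter>d. B d) = 0" by (simp add: measure_le_0_iff)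
  then have "AE \<omega> in M. \<omega> \<notin> (\<Inter>d. B d)"
    using B_sets by (intro AE_not_in) (auto simp: null_sets_def emeasure_eq_measure)
  then show ?thesis using AE_space
  proof eventually_elim
    case (elim \<omega>)
    then obtain d where d: "\<omega> \<notin> B d" by auto
    have "outdeg (X \<omega>) t u < d" if t: "max u v \<le> t" "outdeg (X \<omega>) t u = outdeg (X \<omega>) t v" for t
    proof (rule ccontr)
      assume "\<not> outdeg (X \<omega>) t u < d"
      with t have "P d t (X \<omega>)" by (auto simp: P_def k_def)
      with d elim show False by (auto simp: B_def)
    qed
    then show ?case by blast
  qed
qed

lemma AE_unique_persistent_hub: "AE \<omega> in M. \<exists>u. unique_persistent_hub (X \<omega>) u"
proof -
  have "AE \<omega> in M. \<forall>u v. u \<noteq> v \<longrightarrow>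
      (\<exists>d. \<forall>t\<ge>max u v. outdeg (X \<omega>) t u = outdeg (X \<omega>) t v \<longrightarrow> outdeg (X \<omega>) t u < d)"
    unfolding AE_all_countable by (intro allI AE_impI AE_ties_bounded)
  with AE_valid_code AE_max_deg_unbounded AE_newcomers show ?thesis
    by eventually_elim (rule ex_unique_persistent_hub, blast+)
qed

end

theorem theorem2p17:
  fixes M :: "'a measure" and f :: "nat \<Rightarrow> real" and X :: "'a \<Rightarrow> nat \<Rightarrow> nat"
    and \<kappa> :: real
  assumes "gpa_tree M f X"
    and "\<And>i. f i > 0"
    and "\<kappa> > 0"
    and "\<And>n. (MAX i\<in>{..n}. f i / real (i + 1)) \<le> \<kappa> * (f n / real (n + 1))"
  shows "AE \<omega> in M. \<exists>u. unique_persistent_hub (X \<omega>) u"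
proof -
  interpret prob_space M using assms(1) by (simp add: gpa_tree_def)
  interpret linear_gpa f M X \<kappa>
  proof
    show "gpa_tree M f X" "\<And>i. f i > 0" by fact+
    fix i n :: nat assume "i \<le> n"
    then have "f i / real (i + 1) \<le> (MAX i\<in>{..n}. f i / real (i + 1))" by (intro Max_ge) auto
    also have "\<dots> \<le> \<kappa> * (f n / real (n + 1))" by fact
    finally show "f i / real (i + 1) \<le> \<kappa> * (f n / real (n + 1))" .
  qed
  show ?thesis by (rule AE_unique_persistent_hub)
qed

end
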